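(* Let $\alpha+\beta>0$ and $\gamma+\delta_{in}>0$, and let $\varepsilon>0$ be arbitrarily small. Let $n_{in}(t,d)$ be the number of vertices of in-degree $d$ in the random graph $\mathcal G(t)$ with parameters $\alpha,\beta,\gamma,\delta_{in},\delta_{out},G_0$. Then $$\mathbf E\, n_{in}(t,d)=\overline{f_d}\,t+O\left((d+1)^{-1+\varepsilon}\right)$$ for all integers $t\ge \max(t_0,1)$ and $d\ge 0$, where the implied constant depends only on $\varepsilon$ and on the parameters of the model (including $G_0$), not on $t$ or $d$. Here $\overline{c}_{in}=\frac{1-\gamma}{1+\delta_{in}(\alpha+\gamma)}$, $\overline{f_0}=\frac{\alpha}{1+\delta_{in}\overline{c}_{in}}$, and for $d\ge1$ $$\overline{f_d}=C_{in}\frac{\Gamma(d+\delta_{in})}{\Gamma\left(d+\delta_{in}+1+\frac1{\overline{c}_{in}}\right)},\qquad C_{in}=\frac{\Gamma\left(\delta_{in}+\frac1{\overline{c}_{in}}\right)}{\Gamma(1+\delta_{in})}\cdot\frac{1-\overline{c}_{in}}{\overline{c}_{in}^2}.$$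
   Context: The model $\mathcal G(t)$. Parameters: $\alpha,\beta,\gamma\in[0,1]$ with $\alpha+\beta+\gamma=1$; reals $\delta_{in}\ge0$, $\delta_{out}\ge0$; a fixed finite directed graph $G_0$ (loops and multiple edges allowed) with at least one vertex, and with at least one edge if $\delta_{in}=0$ or $\delta_{out}=0$. Standing assumption: $\alpha+\gamma>0$. Let $t_0$ be the number of edges of $G_0$. At time $t_0$ the random graph is $G_0$. Given the random graph $G$ at time $t\ge t_0$ (it has $t$ edges; let $n$ be its current number of vertices, $d_{in},d_{out}$ its in- and out-degrees), the graph at time $t+1$ is obtained by one of the following, chosen independently of the past: ($\dagger$) with probability $\alpha$, add a new vertex $v$ and an edge from $v$ to an existing vertex $w\in G$ chosen with probability $\frac{d_{in}(w)+\delta_{in}}{t+\delta_{in}n}$; ($\dagger\dagger$) with probability $\beta$, add an edge from $v\in G$ to $w\in G$, where $v$ is chosen with probability $\frac{d_{out}(v)+\delta_{out}}{t+\delta_{out}n}$ and, independently, $w$ with probability $\frac{d_{in}(w)+\delta_{in}}{t+\delta_{in}n}$; ($\ddagger$) with probability $\gamma$, add a new vertex $w$ and an edge to $w$ from an existing vertex $v\in G$ chosen with probability $\frac{d_{out}(v)+\delta_{out}}{t+\delta_{out}n}$. $\mathcal G(t)$ denotes the random graph at time $t$. Under the hypotheses, $0<\overline{c}_{in}<1$. *)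

theory Defs
  imports
    "HOL-Analysis.Gamma_Function"
    "HOL-Probability.Probability_Mass_Function"
    "HOL-Library.Infinite_Typeclass"
    "Graph_Theory.Digraph"
begin

text \<open>
  Directed multigraphs with loops are represented by \<^typ>\<open>('a, 'b) pre_digraph\<close>. The types of
  vertex and arc names are infinite, so that a finite graph always leaves names unused; which
  unused name is given to a new vertex or arc does not matter for degree statistics.
\<close>

definition new_vertex :: "('a::infinite, 'b) pre_digraph \<Rightarrow> 'a" where
  "new_vertex G = (SOME v. v \<notin> verts G)"

definition new_arc :: "('a, 'b::infinite) pre_digraph \<Rightarrow> 'b" where
  "new_arc G = (SOME e. e \<notin> arcs G)"

text \<open>
  The library's \<^const>\<open>pre_digraph.add_arc\<close> adds an arc whose ends are already fixed by the
  graph; here the ends of the new arc \<open>v \<rightarrow> w\<close> are assigned as well. An end that is not yet a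
  vertex is added as a vertex.
\<close>

definition add_edge :: "'a \<Rightarrow> 'a \<Rightarrow> ('a, 'b::infinite) pre_digraph \<Rightarrow> ('a, 'b) pre_digraph" where
  "add_edge v w G =
     \<lparr> verts = insert v (insert w (verts G)),
       arcs = insert (new_arc G) (arcs G),
       tail = (tail G)(new_arc G := v),
       head = (head G)(new_arc G := w) \<rparr>"

lemma fin_digraph_add_edge:
  fixes G :: "('a, 'b::infinite) pre_digraph"
  assumes "fin_digraph G"
  shows "fin_digraph (add_edge v w G)" "card (arcs (add_edge v w G)) = Suc (card (arcs G))"
proof -
  interpret fin_digraph G by fact
  show "fin_digraph (add_edge v w G)"
    by unfold_locales (auto simp: add_edge_def)
  have "new_arc G \<notin> arcs G" unfolding new_arc_def by (rule someI_ex) (simp add: arb_element)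
  then show "card (arcs (add_edge v w G)) = Suc (card (arcs G))" by (simp add: add_edge_def)
qed

text \<open>
  \<^const>\<open>embed_pmf\<close> is only meaningful if the given weights sum to 1. For a finite graph this holds
  whenever the common denominator is positive: both degree sums are the number of arcs.
\<close>

definition pick_in :: "real \<Rightarrow> ('a, 'b) pre_digraph \<Rightarrow> 'a pmf" where
  "pick_in \<delta>\<^sub>i\<^sub>n G = embed_pmf (\<lambda>w.
     if w \<in> verts G
     then (real (in_degree G w) + \<delta>\<^sub>i\<^sub>n) / (real (card (arcs G)) + \<delta>\<^sub>i\<^sub>n * real (card (verts G)))
     else 0)"

definition pick_out :: "real \<Rightarrow> ('a, 'b) pre_digraph \<Rightarrow> 'a pmf" where
  "pick_out \<delta>\<^sub>o\<^sub>u\<^sub>t G = embed_pmf (\<lambda>v.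
     if v \<in> verts G
     then (real (out_degree G v) + \<delta>\<^sub>o\<^sub>u\<^sub>t) / (real (card (arcs G)) + \<delta>\<^sub>o\<^sub>u\<^sub>t * real (card (verts G)))
     else 0)"

lemma (in fin_digraph) sum_in_degree: "(\<Sum>v\<in>verts G. in_degree G v) = card (arcs G)"
proof -
  have "card (\<Union>v\<in>verts G. in_arcs G v) = (\<Sum>v\<in>verts G. card (in_arcs G v))"
    by (rule card_UN_disjoint) (auto simp: in_arcs_def)
  moreover have "(\<Union>v\<in>verts G. in_arcs G v) = arcs G" by (auto simp: in_arcs_def)
  ultimately show ?thesis by (simp add: in_degree_def)
qed

lemma (in fin_digraph) sum_out_degree: "(\<Sum>v\<in>verts G. out_degree G v) = card (arcs G)"
proof -
  have "card (\<Union>v\<in>verts G. out_arcs G v) = (\<Sum>v\<in>verts G. card (out_arcs G v))"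
    by (rule card_UN_disjoint) (auto simp: out_arcs_def)
  moreover have "(\<Union>v\<in>verts G. out_arcs G v) = arcs G" by (auto simp: out_arcs_def)
  ultimately show ?thesis by (simp add: out_degree_def)
qed

lemma pmf_embed_finite:
  fixes g :: "'a \<Rightarrow> real"
  assumes "finite A" "\<And>x. x \<in> A \<Longrightarrow> 0 \<le> g x" "sum g A = 1"
  shows "pmf (embed_pmf (\<lambda>x. if x \<in> A then g x else 0)) x = (if x \<in> A then g x else 0)"
proof (rule pmf_embed_pmf)
  have "(\<integral>\<^sup>+x. ennreal (if x \<in> A then g x else 0) \<partial>count_space UNIV) = (\<Sum>x\<in>A. ennreal (if x \<in> A then g x else 0))"
    by (rule nn_integral_count_space') (use assms in auto)
  also have "\<dots> = ennreal (sum g A)" using assms by (simp add: sum_ennreal)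
  finally show "(\<integral>\<^sup>+x. ennreal (if x \<in> A then g x else 0) \<partial>count_space UNIV) = 1" using assms by simp
qed (use assms in auto)

lemma (in fin_digraph) pmf_pick_in:
  assumes "\<delta> \<ge> 0" "real (card (arcs G)) + \<delta> * real (card (verts G)) > 0"
  shows "pmf (pick_in \<delta> G) w = (if w \<in> verts G
     then (real (in_degree G w) + \<delta>) / (real (card (arcs G)) + \<delta> * real (card (verts G)))
     else 0)"
  unfolding pick_in_def
proof (rule pmf_embed_finite)
  have "(\<Sum>w\<in>verts G. real (in_degree G w) + \<delta>) = real (card (arcs G)) + \<delta> * real (card (verts G))"
    by (simp add: sum.distrib flip: sum_in_degree)
  then show "(\<Sum>w\<in>verts G. (real (in_degree G w) + \<delta>) / (real (card (arcs G)) + \<delta> * real (card (verts G)))) = 1"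
    using assms by (simp flip: sum_divide_distrib)
qed (use assms in auto)

lemma (in fin_digraph) pmf_pick_out:
  assumes "\<delta> \<ge> 0" "real (card (arcs G)) + \<delta> * real (card (verts G)) > 0"
  shows "pmf (pick_out \<delta> G) w = (if w \<in> verts G
     then (real (out_degree G w) + \<delta>) / (real (card (arcs G)) + \<delta> * real (card (verts G)))
     else 0)"
  unfolding pick_out_def
proof (rule pmf_embed_finite)
  have "(\<Sum>w\<in>verts G. real (out_degree G w) + \<delta>) = real (card (arcs G)) + \<delta> * real (card (verts G))"
    by (simp add: sum.distrib flip: sum_out_degree)
  then show "(\<Sum>w\<in>verts G. (real (out_degree G w) + \<delta>) / (real (card (arcs G)) + \<delta> * real (card (verts G)))) = 1"
    using assms by (simp flip: sum_divide_distrib)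
qed (use assms in auto)

datatype move = New_Tail | Old_Ends | New_Head

definition graph_step ::
  "real \<Rightarrow> real \<Rightarrow> real \<Rightarrow> real \<Rightarrow> real
     \<Rightarrow> ('a::infinite, 'b::infinite) pre_digraph \<Rightarrow> ('a, 'b) pre_digraph pmf" where
  "graph_step \<alpha> \<beta> \<gamma> \<delta>\<^sub>i\<^sub>n \<delta>\<^sub>o\<^sub>u\<^sub>t G =
     bind_pmf (pmf_of_list [(New_Tail, \<alpha>), (Old_Ends, \<beta>), (New_Head, \<gamma>)]) (\<lambda>m. case m of
       New_Tail \<Rightarrow> map_pmf (\<lambda>w. add_edge (new_vertex G) w G) (pick_in \<delta>\<^sub>i\<^sub>n G)
     | Old_Ends \<Rightarrow>
         map_pmf (\<lambda>(v, w). add_edge v w G) (pair_pmf (pick_out \<delta>\<^sub>o\<^sub>u\<^sub>t G) (pick_in \<delta>\<^sub>i\<^sub>n G))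
     | New_Head \<Rightarrow> map_pmf (\<lambda>v. add_edge v (new_vertex G) G) (pick_out \<delta>\<^sub>o\<^sub>u\<^sub>t G))"

primrec graph_after ::
  "real \<Rightarrow> real \<Rightarrow> real \<Rightarrow> real \<Rightarrow> real \<Rightarrow> ('a::infinite, 'b::infinite) pre_digraph
     \<Rightarrow> nat \<Rightarrow> ('a, 'b) pre_digraph pmf" where
  "graph_after \<alpha> \<beta> \<gamma> \<delta>\<^sub>i\<^sub>n \<delta>\<^sub>o\<^sub>u\<^sub>t G\<^sub>0 0 = return_pmf G\<^sub>0"
| "graph_after \<alpha> \<beta> \<gamma> \<delta>\<^sub>i\<^sub>n \<delta>\<^sub>o\<^sub>u\<^sub>t G\<^sub>0 (Suc k) =
     bind_pmf (graph_after \<alpha> \<beta> \<gamma> \<delta>\<^sub>i\<^sub>n \<delta>\<^sub>o\<^sub>u\<^sub>t G\<^sub>0 k) (graph_step \<alpha> \<beta> \<gamma> \<delta>\<^sub>i\<^sub>n \<delta>\<^sub>o\<^sub>u\<^sub>t)"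

text \<open>
  The law of the random graph at time \<open>t\<close>. Time starts at the number of arcs of \<open>G\<^sub>0\<close>; the value
  for smaller \<open>t\<close> is irrelevant.
\<close>

definition graph_at ::
  "real \<Rightarrow> real \<Rightarrow> real \<Rightarrow> real \<Rightarrow> real \<Rightarrow> ('a::infinite, 'b::infinite) pre_digraph
     \<Rightarrow> nat \<Rightarrow> ('a, 'b) pre_digraph pmf" where
  "graph_at \<alpha> \<beta> \<gamma> \<delta>\<^sub>i\<^sub>n \<delta>\<^sub>o\<^sub>u\<^sub>t G\<^sub>0 t = graph_after \<alpha> \<beta> \<gamma> \<delta>\<^sub>i\<^sub>n \<delta>\<^sub>o\<^sub>u\<^sub>t G\<^sub>0 (t - card (arcs G\<^sub>0))"

definition n_in :: "('a, 'b) pre_digraph \<Rightarrow> nat \<Rightarrow> nat" where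
  "n_in G d = card {v \<in> verts G. in_degree G v = d}"

definition c_in :: "real \<Rightarrow> real \<Rightarrow> real \<Rightarrow> real" where
  "c_in \<alpha> \<gamma> \<delta>\<^sub>i\<^sub>n = (1 - \<gamma>) / (1 + \<delta>\<^sub>i\<^sub>n * (\<alpha> + \<gamma>))"

definition C_in :: "real \<Rightarrow> real \<Rightarrow> real \<Rightarrow> real" where
  "C_in \<alpha> \<gamma> \<delta>\<^sub>i\<^sub>n =
     (let c = c_in \<alpha> \<gamma> \<delta>\<^sub>i\<^sub>n
      in Gamma (\<delta>\<^sub>i\<^sub>n + 1 / c) / Gamma (1 + \<delta>\<^sub>i\<^sub>n) * ((1 - c) / c\<^sup>2))"

definition f_in :: "real \<Rightarrow> real \<Rightarrow> real \<Rightarrow> nat \<Rightarrow> real" where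
  "f_in \<alpha> \<gamma> \<delta>\<^sub>i\<^sub>n d =
     (let c = c_in \<alpha> \<gamma> \<delta>\<^sub>i\<^sub>n
      in if d = 0 then \<alpha> / (1 + \<delta>\<^sub>i\<^sub>n * c)
         else C_in \<alpha> \<gamma> \<delta>\<^sub>i\<^sub>n * Gamma (real d + \<delta>\<^sub>i\<^sub>n) / Gamma (real d + \<delta>\<^sub>i\<^sub>n + 1 + 1 / c))"

end

theory Submission
  imports Defs "HOL-Real_Asymp.Real_Asymp"
begin

text \<open>
  Condition on the sequence of moves. The number of vertices, and with it the total weight
  \<open>S = t + \<delta> n\<close> of the vertices, is then deterministic, and the conditional expectation \<open>q\<close> of the
  in-degree counts evolves by \<open>q \<mapsto> q + T q / S\<close> for moves that hit an old vertex, where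
  \<open>(T q) d = (d - 1 + \<delta>) q (d - 1) - (d + \<delta>) q d\<close>, plus the contribution of the new vertex. If \<open>\<delta> > 0\<close>, the weight \<open>S\<close>
  fluctuates by order \<open>\<surd>t\<close> around its mean, so replacing it by its mean has to be done with care.
  Since \<open>T\<close> commutes with the evolution, \<open>T q\<close> obeys the recursion of \<open>q\<close>; comparison with
  \<open>g d = 1 / ((d + \<delta>) (d + \<delta> + 1))\<close>, which satisfies \<open>T g \<le> g\<close>, gives \<open>\<bar>T q\<bar> = O(S g)\<close> up to an
  exponentially rare event. With the centred number of vertices \<open>M\<close>, the correlation
  \<open>E (q M)\<close> then satisfies a recursion with source \<open>O(g)\<close>, and as \<open>c_in < 1\<close> it is \<open>O(t g)\<close>.
  Hence the error in the recursion for \<open>E q\<close> is \<open>O(1 / (t (d + 1)))\<close>; summing it along \<open>d\<close> gives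
  \<open>E q = f_in t + O(ln (d + 2) / (d + 1))\<close>.
\<close>

subsection \<open>Averages over sequences of moves\<close>

text \<open>Lists of moves have the latest move first.\<close>

definition vertex_count :: "nat \<Rightarrow> move list \<Rightarrow> nat" where
  "vertex_count n\<^sub>0 ms = n\<^sub>0 + length (filter (\<lambda>m. m \<noteq> Old_Ends) ms)"

definition in_weight :: "real \<Rightarrow> nat \<Rightarrow> nat \<Rightarrow> move list \<Rightarrow> real" where
  "in_weight \<delta> t\<^sub>0 n\<^sub>0 ms = real (t\<^sub>0 + length ms) + \<delta> * real (vertex_count n\<^sub>0 ms)"

text \<open>A real factor, so that one recursion covers all three moves. Only under
  \<open>New_Head\<close> does the new edge end at a new vertex.\<close>

definition hits_old :: "move \<Rightarrow> real" where
  "hits_old m = (if m = New_Head then 0 else 1)"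

text \<open>A new head enters with in-degree 1 because its first edge arrives together with
  it.\<close>

definition born :: "move \<Rightarrow> nat \<Rightarrow> real" where
  "born m d = of_bool (m = New_Tail \<and> d = 0 \<or> m = New_Head \<and> d = 1)"

text \<open>The forward operator of the pure birth chain that leaves degree \<open>d\<close> at rate
  \<open>d + \<delta>\<close>. The test \<open>d = 0\<close> guards against truncated subtraction in
  \<open>d - 1\<close>.\<close>

definition flow :: "real \<Rightarrow> (nat \<Rightarrow> real) \<Rightarrow> nat \<Rightarrow> real" where
  "flow \<delta> y d = (if d = 0 then 0 else (real d - 1 + \<delta>) * y (d - 1)) - (real d + \<delta>) * y d"

text \<open>The expectation over \<open>k\<close> independent moves, computed by averaging out the
  latest move, which is the head of the list. Being a finite recursion, it raises no question of
  integrability.\<close>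

primrec avg :: "real \<Rightarrow> real \<Rightarrow> real \<Rightarrow> nat \<Rightarrow> (move list \<Rightarrow> real) \<Rightarrow> real" where
  "avg \<alpha> \<beta> \<gamma> 0 F = F []"
| "avg \<alpha> \<beta> \<gamma> (Suc k) F = avg \<alpha> \<beta> \<gamma> k
     (\<lambda>ms. \<alpha> * F (New_Tail # ms) + \<beta> * F (Old_Ends # ms) + \<gamma> * F (New_Head # ms))"

lemma vertex_count_simps [simp]:
  "vertex_count n [] = n"
  "vertex_count n (m # ms) = vertex_count n ms + (if m = Old_Ends then 0 else 1)"
  by (auto simp: vertex_count_def)

lemma in_weight_simps [simp]:
  "in_weight \<delta> t n [] = real t + \<delta> * real n"
  "in_weight \<delta> t n (m # ms) = in_weight \<delta> t n ms + 1 + (if m = Old_Ends then 0 else \<delta>)"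
  by (auto simp: in_weight_def algebra_simps)

lemma hits_old_simps [simp]:
  "hits_old New_Tail = 1" "hits_old Old_Ends = 1" "hits_old New_Head = 0"
  by (auto simp: hits_old_def)

section \<open>Linearity and monotonicity of the average\<close>

lemma avg_add: "avg \<alpha> \<beta> \<gamma> k (\<lambda>ms. F ms + G ms) = avg \<alpha> \<beta> \<gamma> k F + avg \<alpha> \<beta> \<gamma> k G"
proof (induction k arbitrary: F G)
  case (Suc k)
  have "avg \<alpha> \<beta> \<gamma> (Suc k) (\<lambda>ms. F ms + G ms) = avg \<alpha> \<beta> \<gamma> k
     (\<lambda>ms. (\<alpha> * F (New_Tail # ms) + \<beta> * F (Old_Ends # ms) + \<gamma> * F (New_Head # ms)) +
           (\<alpha> * G (New_Tail # ms) + \<beta> * G (Old_Ends # ms) + \<gamma> * G (New_Head # ms)))"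
    by (simp add: algebra_simps)
  then show ?case by (simp only: Suc.IH avg.simps)
qed simp

lemma avg_cmult: "avg \<alpha> \<beta> \<gamma> k (\<lambda>ms. c * F ms) = c * avg \<alpha> \<beta> \<gamma> k F"
proof (induction k arbitrary: F)
  case (Suc k)
  have "avg \<alpha> \<beta> \<gamma> (Suc k) (\<lambda>ms. c * F ms) = avg \<alpha> \<beta> \<gamma> k
     (\<lambda>ms. c * (\<alpha> * F (New_Tail # ms) + \<beta> * F (Old_Ends # ms) + \<gamma> * F (New_Head # ms)))"
    by (simp add: algebra_simps)
  then show ?case by (simp only: Suc.IH avg.simps)
qed simp

lemma avg_diff: "avg \<alpha> \<beta> \<gamma> k (\<lambda>ms. F ms - G ms) = avg \<alpha> \<beta> \<gamma> k F - avg \<alpha> \<beta> \<gamma> k G"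
  using avg_add[of \<alpha> \<beta> \<gamma> k F "\<lambda>ms. - 1 * G ms"] avg_cmult[of \<alpha> \<beta> \<gamma> k "-1" G] by simp

lemma avg_mono:
  assumes "\<And>ms. length ms = k \<Longrightarrow> F ms \<le> G ms" "\<alpha> \<ge> 0" "\<beta> \<ge> 0" "\<gamma> \<ge> 0"
  shows "avg \<alpha> \<beta> \<gamma> k F \<le> avg \<alpha> \<beta> \<gamma> k G"
  using assms(1)
proof (induction k arbitrary: F G)
  case (Suc k)
  show ?case unfolding avg.simps
    by (intro Suc.IH add_mono mult_left_mono Suc.prems assms(2-)) auto
qed simp

lemma avg_cong:
  assumes "\<And>ms. length ms = k \<Longrightarrow> F ms = G ms"
  shows "avg \<alpha> \<beta> \<gamma> k F = avg \<alpha> \<beta> \<gamma> k G"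
  using assms
proof (induction k arbitrary: F G)
  case (Suc k)
  show ?case unfolding avg.simps
    by (rule Suc.IH) (simp add: Suc.prems)
qed simp

lemma avg_const:
  assumes "\<alpha> + \<beta> + \<gamma> = 1"
  shows "avg \<alpha> \<beta> \<gamma> k (\<lambda>_. c) = c"
proof (induction k)
  case (Suc k)
  have "\<alpha> * c + \<beta> * c + \<gamma> * c = c" using assms by (metis distrib_right mult_1)
  then show ?case using Suc by simp
qed simp

lemma avg_abs_le:
  assumes "\<And>ms. length ms = k \<Longrightarrow> \<bar>F ms\<bar> \<le> G ms" "\<alpha> \<ge> 0" "\<beta> \<ge> 0" "\<gamma> \<ge> 0"
  shows "\<bar>avg \<alpha> \<beta> \<gamma> k F\<bar> \<le> avg \<alpha> \<beta> \<gamma> k G"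
proof -
  have "avg \<alpha> \<beta> \<gamma> k F \<le> avg \<alpha> \<beta> \<gamma> k G"
    using assms by (intro avg_mono) (fastforce simp: abs_le_iff)+
  moreover have "avg \<alpha> \<beta> \<gamma> k (\<lambda>ms. - 1 * F ms) \<le> avg \<alpha> \<beta> \<gamma> k G"
    using assms by (intro avg_mono) (fastforce simp: abs_le_iff)+
  ultimately show ?thesis by (simp only: avg_cmult)
qed

section \<open>Linearity and comparison for the degree flow\<close>

lemma flow_linear:
  "flow \<delta> (\<lambda>d. x d + y d) d = flow \<delta> x d + flow \<delta> y d"
  "flow \<delta> (\<lambda>d. x d - y d) d = flow \<delta> x d - flow \<delta> y d"
  "flow \<delta> (\<lambda>d. c * y d) d = c * flow \<delta> y d"
  by (auto simp: flow_def algebra_simps)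

lemma avg_flow: "avg \<alpha> \<beta> \<gamma> k (\<lambda>ms. flow \<delta> (y ms) d) = flow \<delta> (\<lambda>d. avg \<alpha> \<beta> \<gamma> k (\<lambda>ms. y ms d)) d"
  \<comment> \<open>This instance evaluates the average of 0, which the branch \<open>d = 0\<close>
    of \<open>flow\<close> requires.\<close>
  using avg_cmult[of \<alpha> \<beta> \<gamma> k 0 "\<lambda>_. 0"] by (simp add: flow_def avg_diff avg_cmult)

lemma abs_flow_le:
  assumes "\<And>d. \<bar>y d\<bar> \<le> Y d" "\<delta> \<ge> 0"
  shows "\<bar>flow \<delta> y d\<bar> \<le> (if d = 0 then 0 else (real d - 1 + \<delta>) * Y (d - 1)) + (real d + \<delta>) * Y d"
proof -
  have "\<bar>(real d + \<delta>) * y d\<bar> \<le> (real d + \<delta>) * Y d"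
    using assms by (simp add: abs_mult mult_left_mono)
  moreover have "\<bar>(real d - 1 + \<delta>) * y (d - 1)\<bar> \<le> (real d - 1 + \<delta>) * Y (d - 1)" if "d \<noteq> 0"
    using assms that by (simp add: abs_mult mult_left_mono)
  ultimately show ?thesis by (auto simp: flow_def)
qed

text \<open>
  One explicit Euler step of the flow is monotone as long as the outflow does not exceed the
  available mass.
\<close>

lemma abs_flow_step_le:
  assumes y: "\<And>d. \<bar>y d\<bar> \<le> Y d" and "\<delta> \<ge> 0" "s \<ge> 0" "s * (real d + \<delta>) \<le> 1"
  shows "\<bar>y d + s * flow \<delta> y d\<bar> \<le> Y d + s * flow \<delta> Y d"
proof -
  define u where "u = (if d = 0 then 0 else (real d - 1 + \<delta>) * y (d - 1))"
  define U where "U = (if d = 0 then 0 else (real d - 1 + \<delta>) * Y (d - 1))"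
  have "\<bar>u\<bar> \<le> U"
    using y[of "d - 1"] \<open>\<delta> \<ge> 0\<close> by (auto simp: u_def U_def abs_mult mult_left_mono)
  then have 1: "\<bar>s * u\<bar> \<le> s * U" using \<open>s \<ge> 0\<close> by (simp add: abs_mult mult_left_mono)
  have 2: "\<bar>(1 - s * (real d + \<delta>)) * y d\<bar> \<le> (1 - s * (real d + \<delta>)) * Y d"
    using y[of d] assms(4) by (simp add: abs_mult mult_left_mono)
  have "y d + s * flow \<delta> y d = (1 - s * (real d + \<delta>)) * y d + s * u"
    and "Y d + s * flow \<delta> Y d = (1 - s * (real d + \<delta>)) * Y d + s * U"
    by (auto simp: flow_def u_def U_def algebra_simps)
  then show ?thesis using 1 2 by linarith
qed

subsection \<open>The comparison function and the rare event\<close>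

definition g_tail :: "real \<Rightarrow> nat \<Rightarrow> real" where
  "g_tail \<delta> d = 1 / ((real d + \<delta>) * (real d + \<delta> + 1))"

lemma g_tail_pos: "\<delta> > 0 \<Longrightarrow> g_tail \<delta> d > 0"
  by (simp add: g_tail_def)

text \<open>Since \<open>(d + \<delta>) * g_tail \<delta> d = 1 / (d + \<delta> + 1)\<close>, the
  flow is a difference of consecutive reciprocals, and for \<open>d \<ge> 1\<close> it equals
  \<open>g_tail \<delta> d\<close>. At \<open>d = 0\<close> only a negative outflow is left.\<close>

lemma flow_g_tail:
  assumes "\<delta> > 0"
  shows "flow \<delta> (g_tail \<delta>) d \<le> g_tail \<delta> d"
proof (cases d)
  case 0
  have "- (1 / (\<delta> + 1)) \<le> 0" using assms by simp
  also have "0 \<le> 1 / (\<delta> * (\<delta> + 1))" using assms by simp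
  finally show ?thesis using 0 assms by (simp add: flow_def g_tail_def)
next
  case (Suc j)
  have [simp]: "real j + \<delta> > 0" "real j + \<delta> \<noteq> 0" "1 + (real j + \<delta>) \<noteq> 0" "2 + (real j + \<delta>) \<noteq> 0"
    using assms by (auto simp: add_pos_nonneg)
  define x where "x = real j + \<delta>"
  have x: "x > 0" unfolding x_def by simp
  have "flow \<delta> (g_tail \<delta>) d = x * (1 / (x * (x + 1))) - (x + 1) * (1 / ((x + 1) * (x + 2)))"
    using Suc by (simp add: flow_def g_tail_def x_def algebra_simps)
  also have "\<dots> = 1 / ((x + 1) * (x + 2))"
    using x by (simp add: divide_simps)
  also have "\<dots> = g_tail \<delta> d" using Suc by (simp add: g_tail_def x_def algebra_simps)
  finally show ?thesis by simp
qed

text \<open>The exponential beats two further powers of \<open>k\<close>, so the terms are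
  eventually dominated by inverse squares.\<close>

lemma summable_poly_geometric:
  fixes \<rho> :: real
  assumes "0 < \<rho>" "\<rho> < 1"
  shows "summable (\<lambda>k. (real k + 1) ^ p * \<rho> ^ k)"
proof (rule summable_comparison_test_ev)
  define \<mu> where "\<mu> = - ln \<rho>"
  have \<mu>: "\<mu> > 0" using assms by (simp add: \<mu>_def)
  have "(\<lambda>k. (real k + 1) ^ (p + 2) * exp (- \<mu> * real k)) \<longlonglongrightarrow> 0"
    using \<mu> by real_asymp
  then have "eventually (\<lambda>k. (real k + 1) ^ (p + 2) * exp (- \<mu> * real k) < 1) sequentially"
    by (rule order_tendstoD) simp
  then show "eventually (\<lambda>k. norm ((real k + 1) ^ p * \<rho> ^ k) \<le> 1 / (real (Suc k)) ^ 2) sequentially"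
  proof eventually_elim
    case (elim k)
    have "exp (- \<mu> * real k) = \<rho> ^ k"
      using assms by (simp add: \<mu>_def mult.commute exp_of_nat_mult)
    then have "((real k + 1) ^ p * \<rho> ^ k) * (real k + 1) ^ 2 \<le> 1"
      using elim by (simp add: power_add power2_eq_square mult_ac)
    then show ?case using assms by (simp add: pos_le_divide_eq add.commute)
  qed
  show "summable (\<lambda>k. 1 / (real (Suc k)) ^ 2)"
    using inverse_power_summable[of 2, where ?'a = real] summable_Suc_iff[of "\<lambda>k. 1 / (real k) ^ 2"]
    by (simp add: field_simps)
qed

text \<open>What the analysis uses of the graph process: \<open>q ms d\<close> stands for the
  expected number of vertices of in-degree \<open>d\<close> given the moves \<open>ms\<close>. The
  exact recursion is \<open>q_Cons\<close>; \<open>q_le\<close> and \<open>q_eq_0\<close> are crude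
  a priori bounds on size and support.\<close>

locale in_degree_counts =
  fixes \<alpha> \<beta> \<gamma> \<delta> :: real and t\<^sub>0 n\<^sub>0 :: nat and q :: "move list \<Rightarrow> nat \<Rightarrow> real"
  assumes nonneg: "\<alpha> \<ge> 0" "\<beta> \<ge> 0" "\<gamma> \<ge> 0" "\<delta> \<ge> 0"
    and sum_1: "\<alpha> + \<beta> + \<gamma> = 1"
    and pos: "\<alpha> + \<gamma> > 0" "\<alpha> + \<beta> > 0" "\<gamma> + \<delta> > 0"
    and start: "n\<^sub>0 \<ge> 1" "real t\<^sub>0 + \<delta> * real n\<^sub>0 > 0"
    and q_nonneg: "q ms d \<ge> 0"
    and q_le: "q ms d \<le> real (vertex_count n\<^sub>0 ms)"
    and q_eq_0: "d > t\<^sub>0 + length ms \<Longrightarrow> q ms d = 0"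
    and q_Cons: "q (m # ms) d =
      q ms d + hits_old m / in_weight \<delta> t\<^sub>0 n\<^sub>0 ms * flow \<delta> (q ms) d + born m d"
begin

abbreviation "E \<equiv> avg \<alpha> \<beta> \<gamma>"
abbreviation "n \<equiv> vertex_count n\<^sub>0"
abbreviation "S \<equiv> in_weight \<delta> t\<^sub>0 n\<^sub>0"
abbreviation "r ms \<equiv> flow \<delta> (q ms)"
abbreviation "g \<equiv> g_tail \<delta>"

section \<open>The random total weight and its mean\<close>

definition "\<nu> = \<alpha> + \<gamma>"
text \<open>The expected growth of the total weight per move; \<open>c_in\<close> equals
  \<open>(1 - \<gamma>) / \<sigma>\<close>.\<close>

definition "\<sigma> = 1 + \<delta> * \<nu>"
definition "mean_weight k = real (t\<^sub>0 + k) + \<delta> * (real n\<^sub>0 + \<nu> * real k)"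
definition "dev ms = real (n ms) - real n\<^sub>0 - \<nu> * real (length ms)"

abbreviation "S' \<equiv> mean_weight"
abbreviation "M \<equiv> dev"

lemma \<nu>: "0 < \<nu>" "\<nu> \<le> 1" using nonneg sum_1 pos by (auto simp: \<nu>_def)

lemma S_eq: "S ms = S' (length ms) + \<delta> * M ms"
  by (simp add: in_weight_def mean_weight_def dev_def algebra_simps)

lemma S_pos: "S ms > 0"
proof -
  have "n ms \<ge> n\<^sub>0" by (simp add: vertex_count_def)
  then have "\<delta> * real (n ms) \<ge> \<delta> * real n\<^sub>0" using nonneg by (simp add: mult_left_mono)
  then show ?thesis using start by (simp add: in_weight_def)
qed

lemma S'_pos: "S' k > 0"
proof -
  have "0 \<le> \<delta> * (\<nu> * real k)" using nonneg \<nu> by simp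
  then show ?thesis using start by (simp add: mean_weight_def distrib_left)
qed

lemma S'_Suc: "S' (Suc k) = S' k + \<sigma>"
  by (simp add: mean_weight_def \<sigma>_def algebra_simps)

text \<open>This is \<open>c_in < 1\<close>: if \<open>\<delta> > 0\<close>, the weight grows faster
  than 1 per move, and otherwise \<open>\<gamma> > 0\<close>. The gap
  \<open>\<sigma> - (1 - \<gamma>)\<close> is what closes the comparison recursions below.\<close>

lemma \<sigma>_gt: "\<sigma> > 1 - \<gamma>"
proof (cases "\<delta> = 0")
  case False
  then have "\<delta> * \<nu> > 0" using nonneg \<nu> by simp
  then show ?thesis using nonneg by (simp add: \<sigma>_def)
next
  case True
  then have "\<delta> * \<nu> = 0" by simp
  then show ?thesis unfolding \<sigma>_def using pos True by linarith
qed

lemma dev_Nil [simp]: "M [] = 0" by (simp add: dev_def)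

lemma dev_Cons: "M (m # ms) = M ms + (if m = Old_Ends then 0 else 1) - \<nu>"
  by (simp add: dev_def algebra_simps)

lemma dev_le: "\<bar>M ms\<bar> \<le> real (length ms)"
proof (induction ms)
  case (Cons m ms)
  then show ?case using \<nu> by (auto simp: dev_Cons)
qed simp

lemma E_mono: "(\<And>ms. length ms = k \<Longrightarrow> F ms \<le> G ms) \<Longrightarrow> E k F \<le> E k G"
  using avg_mono nonneg by blast

lemma E_abs_le: "(\<And>ms. length ms = k \<Longrightarrow> \<bar>F ms\<bar> \<le> G ms) \<Longrightarrow> \<bar>E k F\<bar> \<le> E k G"
  using avg_abs_le nonneg by blast

lemma E_const [simp]: "E k (\<lambda>_. c) = c"
  using avg_const sum_1 by blast

lemma E_dev: "E k M = 0"
proof (induction k)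
  case (Suc k)
  have "E (Suc k) M = E k (\<lambda>ms. M ms)"
    unfolding avg.simps
  proof (rule avg_cong)
    fix ms
    have "\<alpha> * M (New_Tail # ms) + \<beta> * M (Old_Ends # ms) + \<gamma> * M (New_Head # ms) =
      (\<alpha> + \<beta> + \<gamma>) * (M ms - \<nu>) + \<nu>"
      by (simp add: dev_Cons \<nu>_def algebra_simps)
    then show "\<alpha> * M (New_Tail # ms) + \<beta> * M (Old_Ends # ms) + \<gamma> * M (New_Head # ms) = M ms"
      by (simp add: sum_1)
  qed
  then show ?case using Suc by simp
qed simp

text \<open>A move halves \<open>(1/2) ^ n ms\<close> with probability \<open>\<nu>\<close>, hence
  multiplies it by \<open>1 - \<nu>/2\<close> on average. As
  \<open>2 ^ N * (1/2) ^ n ms \<ge> 1\<close> whenever \<open>n ms \<le> N\<close>, this makes a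
  bounded number of vertices exponentially unlikely.\<close>

lemma E_half_power: "E k (\<lambda>ms. (1/2) ^ n ms) \<le> (1 - \<nu>/2) ^ k"
proof (induction k)
  case 0
  then show ?case by (simp add: power_le_one)
next
  case (Suc k)
  have "E (Suc k) (\<lambda>ms. (1/2) ^ n ms) = E k (\<lambda>ms. (1 - \<nu>/2) * (1/2) ^ n ms)"
    unfolding avg.simps
  proof (rule avg_cong)
    fix ms
    have "\<beta> = 1 - \<nu>" using sum_1 by (simp add: \<nu>_def)
    then show "\<alpha> * (1/2) ^ n (New_Tail # ms) + \<beta> * (1/2) ^ n (Old_Ends # ms)
      + \<gamma> * (1/2) ^ n (New_Head # ms) = (1 - \<nu>/2) * (1/2) ^ n ms"
      by (simp add: \<nu>_def field_simps)
  qed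
  also have "\<dots> \<le> (1 - \<nu>/2) * (1 - \<nu>/2) ^ k"
    unfolding avg_cmult using Suc \<nu> by (intro mult_left_mono) auto
  finally show ?case by simp
qed

text \<open>A path-dependent constant for bounding \<open>r\<close> by \<open>S * g\<close>. The
  crude bound on \<open>r\<close> divided by \<open>g\<close> is cubic in \<open>d\<close> when the
  number of vertices is bounded, and the increments pay for it; \<open>(1/2) ^ n ms\<close> replaces
  the indicator of having few vertices.\<close>

primrec defect :: "real \<Rightarrow> real \<Rightarrow> move list \<Rightarrow> real" where
  "defect A B [] = A"
| "defect A B (m # ms) = defect A B ms + B * (real (length ms) + 1) ^ 3 * (1/2) ^ n ms"

lemma defect_ge: "B \<ge> 0 \<Longrightarrow> defect A B ms \<ge> A"
proof (induction ms)
  case (Cons m ms)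
  have "B * (real (length ms) + 1) ^ 3 * (1/2) ^ n ms \<ge> 0" using Cons by simp
  moreover have "defect A B ms \<ge> A" using Cons by simp
  ultimately show ?case unfolding defect.simps by linarith
qed simp

text \<open>The increments of \<open>defect\<close> have summable expectations. They do not depend
  on the latest move, so in the second claim this move is averaged in \<open>M\<close> alone, which
  adds the variance \<open>\<nu> * (1 - \<nu>) \<le> 1\<close>; next to an increment,
  \<open>M\<close> is bounded trivially by the number of moves.\<close>

lemma E_defect_bounded:
  assumes "A \<ge> 0" "B \<ge> 0"
  shows "\<exists>C\<ge>0. \<forall>k. E k (defect A B) \<le> C \<and> E k (\<lambda>ms. defect A B ms * (M ms)\<^sup>2) \<le> C * real k"
proof -
  define \<rho> where "\<rho> = 1 - \<nu>/2"
  have \<rho>: "0 < \<rho>" "\<rho> < 1" using \<nu> by (auto simp: \<rho>_def)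
  \<comment> \<open>Exponent 5: three powers come from \<open>defect\<close> and two from the
    trivial bound on the square of \<open>M\<close>.\<close>
  define b where "b = (\<lambda>k. (real k + 1) ^ 5 * \<rho> ^ k)"
  have b_nonneg: "b k \<ge> 0" for k using \<rho> by (simp add: b_def)
  have "summable b" unfolding b_def by (rule summable_poly_geometric[OF \<rho>])
  then have sum_b: "sum b {..<k} \<le> suminf b" for k
    using b_nonneg by (intro sum_le_suminf) auto
  define C where "C = A + B * suminf b"
  have C: "C \<ge> A" using sum_b[of 0] \<open>B \<ge> 0\<close> by (simp add: C_def)
  let ?a = "\<lambda>k ms. B * (real k + 1) ^ 3 * (1/2) ^ n ms"
  have a_le: "E k (?a k) * (real k + 1)\<^sup>2 \<le> B * b k" for k
  proof -
    have "E k (?a k) * (real k + 1)\<^sup>2 = B * (real k + 1) ^ 5 * E k (\<lambda>ms. (1/2) ^ n ms)"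
      unfolding avg_cmult by (simp add: power2_eq_square power3_eq_cube eval_nat_numeral)
    also have "\<dots> \<le> B * (real k + 1) ^ 5 * \<rho> ^ k"
      using E_half_power[of k] \<open>B \<ge> 0\<close> by (intro mult_left_mono) (auto simp: \<rho>_def)
    finally show ?thesis by (simp add: b_def mult_ac)
  qed
  have a_nonneg: "E k (?a k) \<ge> 0" for k
    using E_mono[of k "\<lambda>_. 0" "?a k"] \<open>B \<ge> 0\<close> by simp
  have a_le': "E k (?a k) \<le> B * b k" for k
  proof -
    have "E k (?a k) * 1 \<le> E k (?a k) * (real k + 1)\<^sup>2"
      using a_nonneg by (intro mult_left_mono) auto
    then show ?thesis using a_le[of k] by linarith
  qed
  have E_Suc: "E (Suc k) (defect A B) = E k (defect A B) + E k (?a k)" for k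
  proof -
    have "E (Suc k) (defect A B) = E k (\<lambda>ms. defect A B ms + ?a k ms)"
      unfolding avg.simps
    proof (rule avg_cong)
      fix ms :: "move list" assume [simp]: "length ms = k"
      have "\<alpha> * x + \<beta> * x + \<gamma> * x = x" for x
        by (metis sum_1 distrib_right mult_1)
      then show "\<alpha> * defect A B (New_Tail # ms) + \<beta> * defect A B (Old_Ends # ms)
         + \<gamma> * defect A B (New_Head # ms) = defect A B ms + ?a k ms" by simp
    qed
    then show ?thesis by (simp only: avg_add)
  qed
  have E1: "E k (defect A B) \<le> A + B * sum b {..<k}" for k
  proof (induction k)
    case (Suc k)
    then show ?case using E_Suc[of k] a_le'[of k] by (simp add: algebra_simps)
  qed simp
  have E1': "E k (defect A B) \<le> C" for k
    using E1[of k] sum_b[of k] \<open>B \<ge> 0\<close> mult_left_mono[of "sum b {..<k}" "suminf b" B] by (simp add: C_def)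
  have E2: "E k (\<lambda>ms. defect A B ms * (M ms)\<^sup>2) \<le> C * real k + B * sum b {..<k}" for k
  proof (induction k)
    case (Suc k)
    have "E (Suc k) (\<lambda>ms. defect A B ms * (M ms)\<^sup>2)
        = E k (\<lambda>ms. (defect A B ms + ?a k ms) * ((M ms)\<^sup>2 + \<nu> * (1 - \<nu>)))"
      unfolding avg.simps
    proof (rule avg_cong)
      fix ms :: "move list" assume [simp]: "length ms = k"
      have \<beta>: "\<beta> = 1 - \<nu>" using sum_1 by (simp add: \<nu>_def)
      define D where "D = defect A B ms + ?a k ms"
      have "\<alpha> * (D * (M ms + 1 - \<nu>)\<^sup>2) + \<beta> * (D * (M ms - \<nu>)\<^sup>2) + \<gamma> * (D * (M ms + 1 - \<nu>)\<^sup>2) =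
         D * (\<nu> * (M ms + 1 - \<nu>)\<^sup>2 + (1 - \<nu>) * (M ms - \<nu>)\<^sup>2)"
        unfolding \<beta> by (simp add: \<nu>_def algebra_simps)
      also have "\<nu> * (M ms + 1 - \<nu>)\<^sup>2 + (1 - \<nu>) * (M ms - \<nu>)\<^sup>2 = (M ms)\<^sup>2 + \<nu> * (1 - \<nu>)"
        by (simp add: power2_eq_square algebra_simps)
      finally show "\<alpha> * (defect A B (New_Tail # ms) * (M (New_Tail # ms))\<^sup>2) +
         \<beta> * (defect A B (Old_Ends # ms) * (M (Old_Ends # ms))\<^sup>2) +
         \<gamma> * (defect A B (New_Head # ms) * (M (New_Head # ms))\<^sup>2) =
         (defect A B ms + ?a k ms) * ((M ms)\<^sup>2 + \<nu> * (1 - \<nu>))"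
        by (simp add: dev_Cons D_def)
    qed
    also have "\<dots> \<le> E k (\<lambda>ms. defect A B ms * (M ms)\<^sup>2 + (defect A B ms + ?a k ms * (real k + 1)\<^sup>2))"
    proof (rule E_mono)
      fix ms :: "move list" assume len: "length ms = k"
      have v: "0 \<le> \<nu> * (1 - \<nu>)" "\<nu> * (1 - \<nu>) \<le> 1"
        using \<nu> by (auto intro!: mult_le_one)
      have "(M ms)\<^sup>2 \<le> (real k)\<^sup>2"
        using dev_le[of ms] len abs_le_square_iff[of "M ms" "real k"] by simp
      then have 1: "(M ms)\<^sup>2 + \<nu> * (1 - \<nu>) \<le> (real k + 1)\<^sup>2"
        using v by (simp add: power2_eq_square algebra_simps)
      have "defect A B ms \<ge> 0" using defect_ge[of B A ms] assms by simp
      then have "defect A B ms * (\<nu> * (1 - \<nu>)) \<le> defect A B ms * 1"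
        using v by (intro mult_left_mono) auto
      moreover have "?a k ms * ((M ms)\<^sup>2 + \<nu> * (1 - \<nu>)) \<le> ?a k ms * (real k + 1)\<^sup>2"
        using 1 \<open>B \<ge> 0\<close> by (intro mult_left_mono) auto
      ultimately show "(defect A B ms + ?a k ms) * ((M ms)\<^sup>2 + \<nu> * (1 - \<nu>)) \<le>
         defect A B ms * (M ms)\<^sup>2 + (defect A B ms + ?a k ms * (real k + 1)\<^sup>2)"
        by (simp add: distrib_left distrib_right)
    qed
    also have "\<dots> = E k (\<lambda>ms. defect A B ms * (M ms)\<^sup>2) + (E k (defect A B) + E k (?a k) * (real k + 1)\<^sup>2)"
      using avg_cmult[of \<alpha> \<beta> \<gamma> k "(real k + 1)\<^sup>2" "?a k"] by (simp add: avg_add mult.commute)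
    also have "\<dots> \<le> (C * real k + B * sum b {..<k}) + (C + B * b k)"
      by (intro add_mono Suc E1' a_le)
    also have "\<dots> = C * real (Suc k) + B * sum b {..<Suc k}"
      by (simp add: algebra_simps)
    finally show ?case .
  qed simp
  show ?thesis
  \<comment> \<open>The second \<open>C\<close> absorbs \<open>B * sum b {..<k}\<close>, which is 0
    for \<open>k = 0\<close> and at most \<open>C\<close> otherwise.\<close>
  proof (rule exI[of _ "2 * C"], intro conjI allI)
    fix k
    show "E k (defect A B) \<le> 2 * C" using E1'[of k] C \<open>A \<ge> 0\<close> by linarith
    have "B * sum b {..<k} \<le> C * real k"
    proof (cases k)
      case (Suc j)
      have "B * sum b {..<k} \<le> C"
        using sum_b[of k] \<open>B \<ge> 0\<close> mult_left_mono[of "sum b {..<k}" "suminf b" B] \<open>A \<ge> 0\<close> by (simp add: C_def)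
      also have "\<dots> \<le> C * real k" using C \<open>A \<ge> 0\<close> Suc by (simp add: mult_le_cancel_left1)
      finally show ?thesis .
    qed simp
    then show "E k (\<lambda>ms. defect A B ms * (M ms)\<^sup>2) \<le> 2 * C * real k" using E2[of k] by simp
  qed (use C assms in simp)
qed

end

text \<open>Up to \<open>k\<^sub>0\<close> only finitely many pairs lie outside the far region, so
  the sum of their ratios is an admissible constant. From \<open>k\<^sub>0\<close> on,
  \<open>step\<close> propagates the bound with the same constant.\<close>

lemma ratio_bounded_by_step:
  fixes y G :: "nat \<Rightarrow> nat \<Rightarrow> real"
  assumes G: "\<And>k d. G k d > 0"
    and far: "\<And>k d. d > N + k \<Longrightarrow> \<bar>y k d\<bar> \<le> C * G k d"
    and step: "\<And>H k d. H \<ge> H\<^sub>0 \<Longrightarrow> k \<ge> k\<^sub>0 \<Longrightarrow> d \<le> N + Suc k \<Longrightarrow>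
      (\<And>j. \<bar>y k j\<bar> \<le> H * G k j) \<Longrightarrow> \<bar>y (Suc k) d\<bar> \<le> H * G (Suc k) d"
  shows "\<exists>H. \<forall>k d. \<bar>y k d\<bar> \<le> H * G k d"
proof -
  define Q where "Q = (\<Sum>k\<le>k\<^sub>0. \<Sum>d\<le>N + k. \<bar>y k d\<bar> / G k d)"
  define H where "H = \<bar>H\<^sub>0\<bar> + \<bar>C\<bar> + Q"
  have nn: "\<bar>y k d\<bar> / G k d \<ge> 0" for k d using G[of k d] by simp
  have "Q \<ge> 0" unfolding Q_def by (intro sum_nonneg nn)
  have HC: "H \<ge> C" "H \<ge> H\<^sub>0" "H \<ge> Q" using \<open>Q \<ge> 0\<close> by (auto simp: H_def)
  have far': "\<bar>y k d\<bar> \<le> H * G k d" if "d > N + k" for k d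
    using far[OF that] mult_right_mono[OF HC(1), of "G k d"] G[of k d] by linarith
  have base: "\<bar>y k d\<bar> \<le> H * G k d" if "k \<le> k\<^sub>0" for k d
  proof (cases "d > N + k")
    case False
    have "\<bar>y k d\<bar> / G k d \<le> (\<Sum>d\<le>N + k. \<bar>y k d\<bar> / G k d)"
      using False by (intro member_le_sum nn) auto
    also have "\<dots> \<le> Q" unfolding Q_def
      using that by (intro member_le_sum[where f = "\<lambda>k. \<Sum>d\<le>N + k. \<bar>y k d\<bar> / G k d"] sum_nonneg nn) auto
    finally show ?thesis using HC G[of k d] by (simp add: pos_divide_le_eq mult_right_mono order_trans)
  qed (rule far')
  have "\<bar>y (k\<^sub>0 + i) d\<bar> \<le> H * G (k\<^sub>0 + i) d" for i d
  proof (induction i arbitrary: d)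
    case (Suc i)
    show ?case
    proof (cases "d > N + (k\<^sub>0 + Suc i)")
      case False
      then show ?thesis using step[OF HC(2), of "k\<^sub>0 + i" d] Suc.IH by simp
    qed (rule far')
  qed (simp add: base)
  then have "\<bar>y k d\<bar> \<le> H * G k d" for k d
    using base[of k d] by (metis le_add_diff_inverse nat_le_linear)
  then show ?thesis by blast
qed

context in_degree_counts
begin

section \<open>Pathwise bound on the flow of the counts\<close>

lemma r_Cons: "r (m # ms) d = r ms d + hits_old m / S ms * flow \<delta> (r ms) d + flow \<delta> (born m) d"
proof -
  have "q (m # ms) = (\<lambda>d. q ms d + hits_old m / S ms * flow \<delta> (q ms) d + born m d)"
    by (rule ext) (rule q_Cons)
  then show ?thesis by (simp only: flow_linear)
qed

lemma r_eq_0: "d > t\<^sub>0 + length ms + 1 \<Longrightarrow> r ms d = 0"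
  by (simp add: flow_def q_eq_0)

text \<open>Inflow and outflow are nonnegative and share the upper bound, which therefore also
  bounds their difference. This serves on the rare event where the comparison argument
  fails.\<close>

lemma abs_r_le: "\<bar>r ms d\<bar> \<le> (real d + \<delta>) * real (n ms)"
proof -
  define u where "u = (if d = 0 then 0 else (real d - 1 + \<delta>) * q ms (d - 1))"
  have "u \<ge> 0" using nonneg q_nonneg[of ms "d - 1"] by (auto simp: u_def)
  moreover have "u \<le> (real d + \<delta>) * real (n ms)"
    using nonneg q_nonneg[of ms "d - 1"] q_le[of ms "d - 1"] by (auto simp: u_def intro!: mult_mono)
  moreover have "(real d + \<delta>) * q ms d \<ge> 0" "(real d + \<delta>) * q ms d \<le> (real d + \<delta>) * real (n ms)"
    using nonneg q_nonneg[of ms d] q_le[of ms d] by (auto intro!: mult_left_mono)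
  moreover have "r ms d = u - (real d + \<delta>) * q ms d" by (simp add: flow_def u_def)
  ultimately show ?thesis by linarith
qed

text \<open>The flow of \<open>born m\<close> lives on degrees up to 2, where it is at most
  \<open>2 + \<delta>\<close> and \<open>g\<close> is at least its value
  \<open>1 / ((2 + \<delta>) * (3 + \<delta>))\<close> at degree 2.\<close>

lemma abs_flow_born_le:
  assumes "\<delta> > 0"
  shows "\<bar>flow \<delta> (born m) d\<bar> \<le> (if m = Old_Ends then 0 else (2 + \<delta>)\<^sup>2 * (3 + \<delta>) * g d)"
proof -
  have "flow \<delta> (born m) d = 0" if "m = Old_Ends \<or> d > 2"
    using that by (auto simp: flow_def born_def)
  moreover have "\<bar>flow \<delta> (born m) d\<bar> \<le> (2 + \<delta>)\<^sup>2 * (3 + \<delta>) * g d" if "d \<le> 2"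
  proof -
    have "d = 0 \<or> d = 1 \<or> d = 2" using that by auto
    then have 1: "\<bar>flow \<delta> (born m) d\<bar> \<le> 2 + \<delta>"
      using assms by (cases m) (auto simp: flow_def born_def)
    have "(real d + \<delta>) * (real d + \<delta> + 1) \<le> (2 + \<delta>) * (3 + \<delta>)"
      using assms that by (intro mult_mono) auto
    then have "1 \<le> (2 + \<delta>) * (3 + \<delta>) * g d"
      using assms by (simp add: g_tail_def divide_simps add_pos_nonneg add_nonneg_pos)
    then have "(2 + \<delta>) * 1 \<le> (2 + \<delta>) * ((2 + \<delta>) * (3 + \<delta>) * g d)"
      using assms by (intro mult_left_mono) auto
    then show ?thesis using 1 by (simp add: power2_eq_square mult_ac)
  qed
  moreover have "(2 + \<delta>)\<^sup>2 * (3 + \<delta>) * g d \<ge> 0"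
    using assms g_tail_pos[of \<delta> d] by simp
  ultimately show ?thesis by (cases "d \<le> 2") auto
qed

text \<open>
  The operator \<^const>\<open>flow\<close> commutes with the evolution, so \<open>r\<close> satisfies the recursion of \<open>q\<close>.
  Comparison with \<open>S ms * g d\<close> only fails if the step size is too large for \<^const>\<open>flow\<close>,
  that is if \<open>S ms < d + \<delta>\<close>; in view of \<open>d \<le> t + 2\<close> there are then fewer than \<open>1 + 2/\<delta>\<close> vertices,
  and \<^const>\<open>defect\<close> pays for this exponentially rare event.
\<close>

lemma abs_r_le_defect:
  assumes "\<delta> > 0"
  shows "\<exists>A\<ge>0. \<exists>B\<ge>0. \<forall>ms d. \<bar>r ms d\<bar> \<le> defect A B ms * S ms * g d"
proof -
  have gp: "g d > 0" for d by (rule g_tail_pos[OF assms])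
  define Cb where "Cb = (2 + \<delta>)\<^sup>2 * (3 + \<delta>)"
  have Cb: "Cb \<ge> 0" using assms by (simp add: Cb_def)
  define A\<^sub>0 where "A\<^sub>0 = (\<Sum>d\<le>t\<^sub>0 + 1. \<bar>r [] d\<bar> / (S [] * g d))"
  have nn: "\<bar>r [] d\<bar> / (S [] * g d) \<ge> 0" for d
    using S_pos[of "[]"] gp[of d] by (intro divide_nonneg_pos mult_pos_pos) auto
  have A0: "A\<^sub>0 \<ge> 0" unfolding A\<^sub>0_def by (intro sum_nonneg nn)
  \<comment> \<open>\<open>A\<^sub>0\<close> covers the initial graph, and
    \<open>Cb / \<delta>\<close> lets the growth of \<open>S\<close> at a birth pay for the source
    term.\<close>
  define A where "A = A\<^sub>0 + Cb / \<delta>"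
  have A: "A \<ge> A\<^sub>0" "A * \<delta> \<ge> Cb" "A \<ge> 0" using A0 Cb assms by (auto simp: A_def algebra_simps)
  define N where "N = nat \<lceil>2 / \<delta> + 1\<rceil>"
  define L where "L = real t\<^sub>0 + 2 + \<delta>"
  have L: "L \<ge> 0" using assms by (simp add: L_def)
  \<comment> \<open>If \<open>n ms \<le> N\<close>, one increment of \<open>defect\<close> now
    exceeds or equals \<open>(N + 1) * (w\<^sup>2 * (w + 1))\<close> for every degree with
    \<open>w = d + \<delta> \<le> L * (length ms + 1)\<close>. This is the crude bound divided by
    \<open>g d\<close>; the 1 in \<open>N + 1\<close> allows for a vertex added by the current
    move.\<close>
  define B where "B = 2 ^ N * ((real N + 1) * (L\<^sup>2 * (L + 1)))"
  have B: "B \<ge> 0" using L by (simp add: B_def)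
  have "\<bar>r ms d\<bar> \<le> defect A B ms * S ms * g d" for ms d
  proof (induction ms arbitrary: d)
    case Nil
    show ?case
    proof (cases "d \<le> t\<^sub>0 + 1")
      case True
      have "\<bar>r [] d\<bar> / (S [] * g d) \<le> A\<^sub>0" unfolding A\<^sub>0_def
        using True by (intro member_le_sum nn) auto
      then have "\<bar>r [] d\<bar> / (S [] * g d) \<le> A" using A by linarith
      then have "\<bar>r [] d\<bar> \<le> A * (S [] * g d)"
        using S_pos[of "[]"] gp[of d] by (simp add: pos_divide_le_eq)
      then show ?thesis by (simp only: defect.simps mult.assoc)
    next
      case False
      then have "r [] d = 0" by (intro r_eq_0) auto
      then show ?thesis using S_pos[of "[]"] gp[of d] A by simp
    qed
  next
    case (Cons m ms)
    define K where "K = defect A B ms"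
    define K' where "K' = defect A B (m # ms)"
    have K: "K \<ge> A" "K' \<ge> A" unfolding K_def K'_def by (rule defect_ge[OF B])+
    have inc: "K' - K = B * (real (length ms) + 1) ^ 3 * (1/2) ^ n ms" by (simp add: K_def K'_def)
    have "B * (real (length ms) + 1) ^ 3 * (1/2) ^ n ms \<ge> 0" using B by simp
    then have KK: "K \<le> K'" using inc by linarith
    have Sm: "S (m # ms) \<ge> S ms + 1" using assms by simp
    have Sp: "S ms > 0" by (rule S_pos)
    consider "d > t\<^sub>0 + length ms + 2" | "real d + \<delta> \<le> S ms"
      | "d \<le> t\<^sub>0 + length ms + 2" "real d + \<delta> > S ms" by linarith
    then show ?case
    proof cases
      case 1
      then have "r (m # ms) d = 0" by (intro r_eq_0) auto
      then show ?thesis using S_pos[of "m # ms"] gp[of d] K A by (simp add: K'_def)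
    next
      case 2
      have h: "hits_old m \<ge> 0" "hits_old m \<le> 1" by (auto simp: hits_old_def)
      have "hits_old m / S ms * (real d + \<delta>) \<le> 1"
        using 2 h Sp assms mult_mono[of "hits_old m" 1 "real d + \<delta>" "S ms"] by (simp add: pos_divide_le_eq)
      then have "\<bar>r ms d + hits_old m / S ms * flow \<delta> (r ms) d\<bar> \<le>
          K * S ms * g d + hits_old m / S ms * flow \<delta> (\<lambda>d. K * S ms * g d) d"
        using Cons.IH h Sp assms by (intro abs_flow_step_le) (auto simp: K_def)
      also have "hits_old m / S ms * flow \<delta> (\<lambda>d. K * S ms * g d) d = K * (hits_old m * flow \<delta> g d)"
        using Sp by (simp add: flow_linear)
      also have "\<dots> \<le> K * g d"
        using flow_g_tail[OF assms, of d] gp[of d] K A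
        by (intro mult_left_mono) (auto simp: hits_old_def)
      finally have 3: "\<bar>r ms d + hits_old m / S ms * flow \<delta> (r ms) d\<bar> \<le> K * S ms * g d + K * g d"
        by simp
      \<comment> \<open>\<open>S\<close> grows by 1 at every move, which absorbs
        \<open>K * g d\<close>, and by \<open>\<delta>\<close> more at a birth, which absorbs the
        flow of \<open>born m\<close>.\<close>
      have "A * \<delta> \<le> K * \<delta>" using K assms by simp
      then have "Cb \<le> K * \<delta>" using A by linarith
      then have "(if m = Old_Ends then 0 else Cb * g d) \<le> K * (if m = Old_Ends then 0 else \<delta>) * g d"
        using gp[of d] by (auto intro!: mult_right_mono)
      then have "\<bar>r (m # ms) d\<bar> \<le> K * S (m # ms) * g d"
        using 3 abs_flow_born_le[OF assms, of m d] unfolding r_Cons[of m ms d]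
        by (auto simp: Cb_def algebra_simps)
      also have "\<dots> \<le> K' * S (m # ms) * g d"
        using KK gp[of d] S_pos[of "m # ms"] by (intro mult_right_mono) auto
      finally show ?thesis by (simp only: K'_def)
    next
      case 3
      define w where "w = real d + \<delta>"
      have w: "w > 0" using assms by (simp add: w_def)
      have "real d > real (t\<^sub>0 + length ms) + \<delta> * real (n ms) - \<delta>"
        using 3 by (simp add: in_weight_def)
      then have "\<delta> * real (n ms) < 2 + \<delta>" using 3(1) by linarith
      then have "real (n ms) < 2 / \<delta> + 1" using assms by (simp add: field_simps)
      then have nN: "n ms \<le> N" unfolding N_def by linarith
      have "w \<le> real t\<^sub>0 + 2 + \<delta> + real (length ms)" using 3(1) by (simp add: w_def)
      also have "\<dots> \<le> L * (real (length ms) + 1)"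
        using assms mult_right_mono[of 1 L "real (length ms)"] by (simp add: L_def algebra_simps)
      finally have wL: "w \<le> L * (real (length ms) + 1)" .
      have "w\<^sup>2 * (w + 1) \<le> (L * (real (length ms) + 1))\<^sup>2 * ((L + 1) * (real (length ms) + 1))"
        using wL w L by (intro mult_mono power_mono) (auto simp: algebra_simps)
      also have "\<dots> = L\<^sup>2 * (L + 1) * (real (length ms) + 1) ^ 3"
        by (simp add: power2_eq_square power3_eq_cube)
      finally have w3: "w\<^sup>2 * (w + 1) \<le> L\<^sup>2 * (L + 1) * (real (length ms) + 1) ^ 3" .
      have "(1::real) \<le> 2 ^ N * (1/2) ^ n ms"
      proof -
        have "(1::real) = 2 ^ n ms * (1/2) ^ n ms" by (simp add: power_mult_distrib[symmetric])
        also have "\<dots> \<le> 2 ^ N * (1/2) ^ n ms" using nN by (intro mult_right_mono power_increasing) auto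
        finally show ?thesis .
      qed
      then have "((real N + 1) * (L\<^sup>2 * (L + 1)) * (real (length ms) + 1) ^ 3) * 1 \<le>
          ((real N + 1) * (L\<^sup>2 * (L + 1)) * (real (length ms) + 1) ^ 3) * (2 ^ N * (1/2) ^ n ms)"
        using L by (intro mult_left_mono) auto
      also have "\<dots> = K' - K" unfolding inc B_def by (simp add: mult_ac)
      finally have "(real N + 1) * (L\<^sup>2 * (L + 1) * (real (length ms) + 1) ^ 3) \<le> K'"
        using K A by (simp add: mult_ac)
      moreover have "(real N + 1) * (w\<^sup>2 * (w + 1)) \<le> (real N + 1) * (L\<^sup>2 * (L + 1) * (real (length ms) + 1) ^ 3)"
        using w3 by (intro mult_left_mono) auto
      ultimately have "(real N + 1) * (w\<^sup>2 * (w + 1)) \<le> K' * 1" by linarith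
      also have "\<dots> \<le> K' * S (m # ms)"
        using K A Sp Sm by (intro mult_left_mono) auto
      finally have "(real N + 1) * (w\<^sup>2 * (w + 1)) * g d \<le> K' * S (m # ms) * g d"
        using gp[of d] by (intro mult_right_mono) auto
      moreover have "(real N + 1) * (w\<^sup>2 * (w + 1)) * g d = w * (real N + 1)"
        using w unfolding g_tail_def w_def[symmetric] by (simp add: power2_eq_square)
      moreover have "w * real (n (m # ms)) \<le> w * (real N + 1)"
        using nN w by (intro mult_left_mono) auto
      ultimately show ?thesis
        using abs_r_le[of "m # ms" d] unfolding K'_def w_def[symmetric] by linarith
    qed
  qed
  then show ?thesis using A B by blast
qed


subsection \<open>Correlation with the number of vertices\<close>

text \<open>By \<open>\<sigma> > 1 - \<gamma>\<close> the mean weight eventually outgrows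
  \<open>(1 - \<gamma>) * (d + \<delta>)\<close> over all degrees that can occur. This is the step
  size condition of \<open>abs_flow_step_le\<close>.\<close>

lemma steps_small: "\<exists>k\<^sub>0. \<forall>k\<ge>k\<^sub>0. \<forall>d\<le>t\<^sub>0 + Suc k. (1 - \<gamma>) / S' k * (real d + \<delta>) \<le> 1"
proof -
  have g1: "1 - \<gamma> \<ge> 0" using sum_1 nonneg by linarith
  define a where "a = \<sigma> - (1 - \<gamma>)"
  have a: "a > 0" using \<sigma>_gt by (simp add: a_def)
  define k\<^sub>0 where "k\<^sub>0 = nat \<lceil>(1 - \<gamma>) * (real t\<^sub>0 + 1 + \<delta>) / a\<rceil>"
  have "(1 - \<gamma>) / S' k * (real d + \<delta>) \<le> 1" if "k \<ge> k\<^sub>0" "d \<le> t\<^sub>0 + Suc k" for k d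
  proof -
    have "(1 - \<gamma>) * (real t\<^sub>0 + 1 + \<delta>) / a \<le> real k" using that(1) unfolding k\<^sub>0_def by linarith
    then have 1: "(1 - \<gamma>) * (real t\<^sub>0 + 1 + \<delta>) \<le> real k * a" using a by (simp add: pos_divide_le_eq)
    have "(1 - \<gamma>) * (real d + \<delta>) \<le> (1 - \<gamma>) * (real t\<^sub>0 + 1 + \<delta> + real k)"
      using that(2) g1 by (intro mult_left_mono) auto
    also have "\<dots> \<le> real k * a + real k * (1 - \<gamma>)" using 1 by (simp add: algebra_simps)
    also have "\<dots> = real k * \<sigma>" by (simp add: a_def algebra_simps)
    also have "\<dots> \<le> S' k" using nonneg by (simp add: mean_weight_def \<sigma>_def algebra_simps)
    finally show ?thesis using S'_pos[of k] by (simp add: pos_divide_le_eq)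
  qed
  then show ?thesis by blast
qed

lemma S'_ge: "real k \<le> S' k"
proof -
  have "\<delta> * (real n\<^sub>0 + \<nu> * real k) \<ge> 0" using nonneg \<nu> by simp
  then show ?thesis by (simp add: mean_weight_def)
qed

text \<open>An exact identity in place of an expansion: each use trades the random weight for its
  mean at the price of one factor \<open>M / S'\<close>.\<close>

lemma divide_S:
  assumes "length ms = k"
  shows "x / S ms = x / S' k - \<delta> / S' k * (M ms * x / S ms)"
proof -
  have "S ms = S' k + \<delta> * M ms" using S_eq[of ms] assms by simp
  then have "x * S' k = x * S ms - \<delta> * M ms * x" by (simp add: algebra_simps)
  then show ?thesis using S_pos[of ms] S'_pos[of k] by (simp add: field_simps)
qed

text \<open>Dividing the pathwise bound on \<open>r\<close> by \<open>S\<close> leaves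
  \<open>g d * defect\<close>, whose moments are under control.\<close>

lemma E_moments_r:
  assumes "\<delta> > 0"
  shows "\<exists>C\<ge>0. \<forall>k d. \<bar>E k (\<lambda>ms. r ms d / S ms)\<bar> \<le> C * g d \<and>
    \<bar>E k (\<lambda>ms. (M ms)\<^sup>2 * r ms d / S ms)\<bar> \<le> C * real k * g d"
proof -
  obtain A B where AB: "A \<ge> 0" "B \<ge> 0" and r: "\<And>ms d. \<bar>r ms d\<bar> \<le> defect A B ms * S ms * g d"
    using abs_r_le_defect[OF assms] by blast
  obtain C where C: "C \<ge> 0" "\<And>k. E k (defect A B) \<le> C"
    "\<And>k. E k (\<lambda>ms. defect A B ms * (M ms)\<^sup>2) \<le> C * real k"
    using E_defect_bounded[OF AB] by blast
  have r': "\<bar>r ms d / S ms\<bar> \<le> g d * defect A B ms" for ms d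
    using r[of ms d] S_pos[of ms] by (simp add: pos_divide_le_eq mult_ac)
  have "\<bar>E k (\<lambda>ms. r ms d / S ms)\<bar> \<le> g d * E k (defect A B)" for k d
    using E_abs_le[of k "\<lambda>ms. r ms d / S ms" "\<lambda>ms. g d * defect A B ms"] r' by (simp add: avg_cmult)
  also have "g d * E k (defect A B) \<le> g d * C" for k d
    using C g_tail_pos[OF assms, of d] by (intro mult_left_mono) auto
  finally have 1: "\<bar>E k (\<lambda>ms. r ms d / S ms)\<bar> \<le> C * g d" for k d by (simp add: mult.commute)
  have "\<bar>(M ms)\<^sup>2 * r ms d / S ms\<bar> \<le> g d * (defect A B ms * (M ms)\<^sup>2)" for ms d
    using mult_left_mono[OF r'[of ms d], of "(M ms)\<^sup>2"] by (simp add: abs_mult mult_ac)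
  then have "\<bar>E k (\<lambda>ms. (M ms)\<^sup>2 * r ms d / S ms)\<bar> \<le> g d * E k (\<lambda>ms. defect A B ms * (M ms)\<^sup>2)" for k d
    using E_abs_le[of k "\<lambda>ms. (M ms)\<^sup>2 * r ms d / S ms" "\<lambda>ms. g d * (defect A B ms * (M ms)\<^sup>2)"]
    by (simp add: avg_cmult)
  also have "g d * E k (\<lambda>ms. defect A B ms * (M ms)\<^sup>2) \<le> g d * (C * real k)" for k d
    using C g_tail_pos[OF assms, of d] by (intro mult_left_mono) auto
  finally have 2: "\<bar>E k (\<lambda>ms. (M ms)\<^sup>2 * r ms d / S ms)\<bar> \<le> C * real k * g d" for k d
    by (simp add: mult_ac)
  show ?thesis using 1 2 C(1) by blast
qed

text \<open>The covariance of the conditional count with the number of vertices, as \<open>M\<close>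
  has mean 0.\<close>

definition "q_dev k d = E k (\<lambda>ms. q ms d * M ms)"

text \<open>For a fixed list of moves, \<open>M\<close> is a scalar and passes through
  \<open>flow\<close>; \<open>divide_S\<close> then leaves a remainder with the square of
  \<open>M\<close>, which has order \<open>k\<close> on average.\<close>

lemma E_r_dev: "E k (\<lambda>ms. M ms * r ms d / S ms) =
  flow \<delta> (q_dev k) d / S' k - \<delta> / S' k * E k (\<lambda>ms. (M ms)\<^sup>2 * r ms d / S ms)"
proof -
  have "E k (\<lambda>ms. M ms * r ms d / S ms) =
    E k (\<lambda>ms. 1 / S' k * flow \<delta> (\<lambda>d. q ms d * M ms) d - \<delta> / S' k * ((M ms)\<^sup>2 * r ms d / S ms))"
  proof (rule avg_cong)
    fix ms :: "move list" assume "length ms = k"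
    moreover have "flow \<delta> (\<lambda>d. q ms d * M ms) d = M ms * r ms d"
      by (simp add: flow_def algebra_simps)
    ultimately show "M ms * r ms d / S ms =
        1 / S' k * flow \<delta> (\<lambda>d. q ms d * M ms) d - \<delta> / S' k * ((M ms)\<^sup>2 * r ms d / S ms)"
      using divide_S[of ms k "M ms * r ms d"] by (simp add: power2_eq_square mult_ac)
  qed
  then show ?thesis unfolding avg_diff avg_cmult avg_flow q_dev_def by simp
qed

text \<open>The product of the increments of \<open>q\<close> and \<open>M\<close> contributes the
  last two terms: \<open>\<alpha> * (1 - \<nu>) - \<beta> * \<nu>\<close> is the mean of
  \<open>hits_old\<close> times the increment of \<open>M\<close>, and the birth terms carry the
  increment \<open>1 - \<nu>\<close>. The births multiplied by the old \<open>M\<close> average to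
  0.\<close>

lemma q_dev_Suc: "q_dev (Suc k) d = q_dev k d + (1 - \<gamma>) * E k (\<lambda>ms. M ms * r ms d / S ms)
   + (\<alpha> * (1 - \<nu>) - \<beta> * \<nu>) * E k (\<lambda>ms. r ms d / S ms)
   + (\<alpha> * of_bool (d = 0) + \<gamma> * of_bool (d = 1)) * (1 - \<nu>)"
proof -
  let ?b = "\<alpha> * of_bool (d = 0) + \<gamma> * of_bool (d = 1)"
  have \<beta>: "\<beta> = 1 - \<nu>" and \<gamma>: "\<gamma> = \<nu> - \<alpha>" using sum_1 by (simp_all add: \<nu>_def)
  have "q_dev (Suc k) d = E k (\<lambda>ms. (q ms d * M ms + (1 - \<gamma>) * (M ms * r ms d / S ms)
     + (\<alpha> * (1 - \<nu>) - \<beta> * \<nu>) * (r ms d / S ms)) + (?b * M ms + ?b * (1 - \<nu>)))"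
    unfolding q_dev_def avg.simps
  proof (rule avg_cong)
    fix ms
    \<comment> \<open>Stated over plain reals: once \<open>\<beta>\<close> and
      \<open>\<gamma>\<close> are eliminated, it is a polynomial identity.\<close>
    have "a * ((x + y + e) * (m + 1 - v)) + b * ((x + y) * (m - v)) + c * ((x + f) * (m + 1 - v))
      = (x * m + (1 - c) * (m * y) + (a * (1 - v) - b * v) * y)
        + ((a * e + c * f) * m + (a * e + c * f) * (1 - v))"
      if "b = 1 - v" "c = v - a" for a b c e f m v x y :: real
      unfolding that by (simp add: algebra_simps)
    from this[OF \<beta> \<gamma>, of "q ms d" "r ms d / S ms" "of_bool (d = 0)" "M ms" "of_bool (d = 1)"]
    show "\<alpha> * (q (New_Tail # ms) d * M (New_Tail # ms)) + \<beta> * (q (Old_Ends # ms) d * M (Old_Ends # ms))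
       + \<gamma> * (q (New_Head # ms) d * M (New_Head # ms)) =
      (q ms d * M ms + (1 - \<gamma>) * (M ms * r ms d / S ms)
     + (\<alpha> * (1 - \<nu>) - \<beta> * \<nu>) * (r ms d / S ms)) + (?b * M ms + ?b * (1 - \<nu>))"
      by (simp add: q_Cons dev_Cons born_def)
  qed
  then show ?thesis unfolding avg_add avg_cmult by (simp add: E_dev q_dev_def)
qed

text \<open>The homogeneous step raises the comparison function \<open>S' k * g d\<close> by at most
  \<open>(1 - \<gamma>) * g d\<close>, whereas \<open>S'\<close> itself grows by
  \<open>\<sigma>\<close>. The surplus \<open>a = \<sigma> - (1 - \<gamma>)\<close> absorbs a source
  of order \<open>g d\<close> once \<open>H * a \<ge> Q\<close>.\<close>

lemma q_dev_bounded:
  assumes "\<delta> > 0"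
  shows "\<exists>H. \<forall>k d. \<bar>q_dev k d\<bar> \<le> H * (S' k * g d)"
proof -
  have gp: "g d > 0" for d by (rule g_tail_pos[OF assms])
  have g1: "0 \<le> 1 - \<gamma>" "1 - \<gamma> \<le> 1" using sum_1 nonneg by linarith+
  obtain C where C: "C \<ge> 0" "\<And>k d. \<bar>E k (\<lambda>ms. r ms d / S ms)\<bar> \<le> C * g d"
    "\<And>k d. \<bar>E k (\<lambda>ms. (M ms)\<^sup>2 * r ms d / S ms)\<bar> \<le> C * real k * g d"
    using E_moments_r[OF assms] by blast
  \<comment> \<open>The three summands bound the remainder with the square of \<open>M\<close>, the
    correlation of \<open>hits_old\<close> with the increment of \<open>M\<close>, and the births;
    \<open>(1 + \<delta>) * (2 + \<delta>)\<close> is \<open>1 / g 1\<close>.\<close>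
  define Q where "Q = C * \<delta> + C + (1 + \<delta>) * (2 + \<delta>)"
  define s where "s k = (1 - \<gamma>) / S' k" for k
  have step: "\<bar>q_dev (Suc k) d - (q_dev k d + s k * flow \<delta> (q_dev k) d)\<bar> \<le> Q * g d" for k d
  proof -
    define x1 where "x1 = s k * (\<delta> * E k (\<lambda>ms. (M ms)\<^sup>2 * r ms d / S ms))"
    define x2 where "x2 = (\<alpha> * (1 - \<nu>) - \<beta> * \<nu>) * E k (\<lambda>ms. r ms d / S ms)"
    define x3 where "x3 = (\<alpha> * of_bool (d = 0) + \<gamma> * of_bool (d = 1)) * (1 - \<nu>)"
    have "s k * real k \<le> 1"
      using S'_ge[of k] S'_pos[of k] g1 mult_mono[of "1 - \<gamma>" 1 "real k" "S' k"]
      by (simp add: s_def pos_divide_le_eq)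
    then have "(s k * real k) * (\<delta> * C * g d) \<le> 1 * (\<delta> * C * g d)"
      using C(1) assms gp[of d] by (intro mult_right_mono) auto
    moreover have "\<bar>x1\<bar> \<le> s k * (\<delta> * (C * real k * g d))"
      unfolding x1_def abs_mult using C(3)[of k d] g1 S'_pos[of k] assms
      by (intro mult_mono) (auto simp: s_def)
    ultimately have x1: "\<bar>x1\<bar> \<le> C * \<delta> * g d" by (simp add: mult_ac)
    have "\<alpha> * (1 - \<nu>) \<le> 1" "\<beta> * \<nu> \<le> 1" "\<alpha> * (1 - \<nu>) \<ge> 0" "\<beta> * \<nu> \<ge> 0"
      using nonneg sum_1 \<nu> by (auto intro!: mult_le_one)
    then have "\<bar>\<alpha> * (1 - \<nu>) - \<beta> * \<nu>\<bar> \<le> 1" by linarith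
    then have x2: "\<bar>x2\<bar> \<le> C * g d"
      unfolding x2_def abs_mult using C(2)[of k d] mult_mono[of "\<bar>\<alpha> * (1 - \<nu>) - \<beta> * \<nu>\<bar>" 1] by fastforce
    have x3: "\<bar>x3\<bar> \<le> (1 + \<delta>) * (2 + \<delta>) * g d"
    proof (cases "d \<le> 1")
      case True
      then have "d = 0 \<or> d = 1" by auto
      then have "\<bar>\<alpha> * of_bool (d = 0) + \<gamma> * of_bool (d = 1)\<bar> \<le> 1" using nonneg sum_1 by auto
      then have "\<bar>x3\<bar> \<le> 1" unfolding x3_def abs_mult using \<nu> by (intro mult_le_one) auto
      also have "(real d + \<delta>) * (real d + \<delta> + 1) \<le> (1 + \<delta>) * (2 + \<delta>)"
        using assms True by (intro mult_mono) auto
      then have "1 \<le> (1 + \<delta>) * (2 + \<delta>) * g d"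
        using assms by (simp add: g_tail_def divide_simps add_pos_nonneg add_nonneg_pos)
      finally show ?thesis .
    next
      case False
      then have "x3 = 0" by (simp add: x3_def)
      then show ?thesis using gp[of d] assms by simp
    qed
    have "q_dev (Suc k) d - (q_dev k d + s k * flow \<delta> (q_dev k) d) = - x1 + x2 + x3"
      unfolding q_dev_Suc E_r_dev x1_def x2_def x3_def s_def by (simp add: algebra_simps)
    then show ?thesis using x1 x2 x3 unfolding Q_def distrib_right by linarith
  qed
  obtain k\<^sub>0 where k0: "\<And>k d. k \<ge> k\<^sub>0 \<Longrightarrow> d \<le> t\<^sub>0 + Suc k \<Longrightarrow> s k * (real d + \<delta>) \<le> 1"
    using steps_small unfolding s_def by blast
  define a where "a = \<sigma> - (1 - \<gamma>)"
  have a: "a > 0" using \<sigma>_gt by (simp add: a_def)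
  show ?thesis
  proof (rule ratio_bounded_by_step[where N = t\<^sub>0 and C = 0 and k\<^sub>0 = k\<^sub>0 and H\<^sub>0 = "\<bar>Q\<bar> / a"])
    show "S' k * g d > 0" for k d using S'_pos[of k] gp[of d] by simp
    show "\<bar>q_dev k d\<bar> \<le> 0 * (S' k * g d)" if "d > t\<^sub>0 + k" for k d
    proof -
      have "q_dev k d = E k (\<lambda>_. 0)" unfolding q_dev_def by (rule avg_cong) (use that in \<open>simp add: q_eq_0\<close>)
      then show ?thesis by simp
    qed
    show "\<bar>q_dev (Suc k) d\<bar> \<le> H * (S' (Suc k) * g d)"
      if H: "H \<ge> \<bar>Q\<bar> / a" and k: "k \<ge> k\<^sub>0" "d \<le> t\<^sub>0 + Suc k" and IH: "\<And>j. \<bar>q_dev k j\<bar> \<le> H * (S' k * g j)" for H k d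
    proof -
      have "\<bar>Q\<bar> / a \<ge> 0" using a by simp
      then have H0: "H \<ge> 0" using H by linarith
      have Q: "Q \<le> H * a" using H a by (simp add: pos_divide_le_eq)
      have "\<bar>q_dev k d + s k * flow \<delta> (q_dev k) d\<bar> \<le> H * (S' k * g d) + s k * flow \<delta> (\<lambda>d. H * (S' k * g d)) d"
        using IH assms k0[OF k] g1 S'_pos[of k] by (intro abs_flow_step_le) (auto simp: s_def)
      also have "s k * flow \<delta> (\<lambda>d. H * (S' k * g d)) d = H * (1 - \<gamma>) * flow \<delta> g d"
        using S'_pos[of k] by (simp add: flow_linear s_def)
      also have "\<dots> \<le> H * (1 - \<gamma>) * g d"
        using flow_g_tail[OF assms] H0 g1 by (intro mult_left_mono) auto
      finally have "\<bar>q_dev (Suc k) d\<bar> \<le> H * (S' k * g d) + H * (1 - \<gamma>) * g d + Q * g d"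
        using step[of k d] by linarith
      moreover have "Q * g d \<le> H * a * g d" using Q gp[of d] by (intro mult_right_mono) auto
      ultimately show ?thesis by (simp add: S'_Suc a_def algebra_simps)
    qed
  qed
qed

text \<open>The error made when the recursion for the mean counts is closed with the mean
  weight.\<close>

definition "drift_error k d = E k (\<lambda>ms. r ms d / S ms) - flow \<delta> (\<lambda>d. E k (\<lambda>ms. q ms d)) d / S' k"

lemma drift_error_eq:
  "drift_error k d = - (\<delta> / S' k) * E k (\<lambda>ms. M ms * r ms d / S ms)"
proof -
  have "E k (\<lambda>ms. r ms d / S ms) =
      E k (\<lambda>ms. 1 / S' k * r ms d - \<delta> / S' k * (M ms * r ms d / S ms))"
  proof (rule avg_cong)
    fix ms :: "move list" assume "length ms = k"
    then show "r ms d / S ms = 1 / S' k * r ms d - \<delta> / S' k * (M ms * r ms d / S ms)"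
      using divide_S[of ms k "r ms d"] by simp
  qed
  then show ?thesis unfolding avg_diff avg_cmult avg_flow drift_error_def by simp
qed

text \<open>For \<open>\<delta> = 0\<close> the weight is deterministic. Otherwise
  \<open>flow\<close> costs \<open>q_dev\<close> one power of \<open>d\<close>, since
  \<open>(d + \<delta>) * g d\<close> has order \<open>1 / (d + 1)\<close>. The average of
  \<open>M * r / S\<close> then has this order, and the prefactor \<open>\<delta> / S' k\<close>
  supplies the decay in time.\<close>

lemma drift_error_bounded: "\<exists>C\<ge>0. \<forall>k d. \<bar>drift_error k d\<bar> \<le> C / ((real d + 1) * S' k)"
proof (cases "\<delta> = 0")
  case True
  have "drift_error k d = 0" for k d unfolding drift_error_eq using True by simp
  then show ?thesis by (intro exI[of _ 0]) simp
next
  case False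
  then have \<delta>: "\<delta> > 0" using nonneg by simp
  have gp: "g d > 0" for d by (rule g_tail_pos[OF \<delta>])
  have g_le: "g d \<le> 1 / \<delta> * (1 / (real d + 1))" for d
  proof -
    have "\<delta> * (real d + 1) \<le> (real d + \<delta>) * (real d + \<delta> + 1)" using \<delta> by (intro mult_mono) auto
    then have "1 / ((real d + \<delta>) * (real d + \<delta> + 1)) \<le> 1 / (\<delta> * (real d + 1))"
      using \<delta> by (intro divide_left_mono) auto
    then show ?thesis by (simp add: g_tail_def)
  qed
  have wg: "(if d = 0 then 0 else (real d - 1 + \<delta>) * g (d - 1)) + (real d + \<delta>) * g d \<le> 3 / (real d + 1)" for d
  proof -
    have eq: "(real j + \<delta>) * g j = 1 / (real j + \<delta> + 1)" for j
      using \<delta> by (simp add: g_tail_def add_nonneg_pos)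
    have 1: "(real d + \<delta>) * g d \<le> 1 / (real d + 1)" unfolding eq using \<delta> by (intro divide_left_mono) auto
    have 2: "(if d = 0 then 0 else (real d - 1 + \<delta>) * g (d - 1)) \<le> 2 / (real d + 1)"
    proof (cases d)
      case (Suc j)
      then have "(real d - 1 + \<delta>) * g (d - 1) = 1 / (real j + \<delta> + 1)" using eq[of j] by simp
      also have "\<dots> \<le> 2 / (real d + 1)" using Suc \<delta> by (simp add: field_simps)
      finally show ?thesis using Suc by simp
    qed simp
    show ?thesis using add_mono[OF 2 1] by (simp add: add_divide_distrib[symmetric])
  qed
  obtain C where C: "C \<ge> 0" "\<And>k d. \<bar>E k (\<lambda>ms. (M ms)\<^sup>2 * r ms d / S ms)\<bar> \<le> C * real k * g d"
    using E_moments_r[OF \<delta>] by blast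
  obtain H where H: "\<And>k d. \<bar>q_dev k d\<bar> \<le> H * (S' k * g d)"
    using q_dev_bounded[OF \<delta>] by blast
  have H0: "H \<ge> 0"
  proof -
    have "0 \<le> H * (S' 0 * g 0)" using H[of 0 0] by linarith
    moreover have "S' 0 * g 0 > 0" using S'_pos[of 0] gp[of 0] by simp
    ultimately show ?thesis by (metis mult_less_0_iff not_le)
  qed
  have "\<bar>drift_error k d\<bar> \<le> (3 * \<delta> * H + \<delta> * C) / ((real d + 1) * S' k)" for k d
  proof -
    have Sp: "S' k > 0" by (rule S'_pos)
    have "\<bar>flow \<delta> (q_dev k) d\<bar> \<le> (if d = 0 then 0 else (real d - 1 + \<delta>) * (H * (S' k * g (d - 1)))) + (real d + \<delta>) * (H * (S' k * g d))"
      by (rule abs_flow_le[where y = "q_dev k" and Y = "\<lambda>d. H * (S' k * g d)", OF H nonneg(4)])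
    also have "\<dots> = (H * S' k) * ((if d = 0 then 0 else (real d - 1 + \<delta>) * g (d - 1)) + (real d + \<delta>) * g d)"
      by (simp add: algebra_simps)
    also have "\<dots> \<le> (H * S' k) * (3 / (real d + 1))"
      using H0 Sp wg[of d] by (intro mult_left_mono) auto
    finally have "\<bar>flow \<delta> (q_dev k) d\<bar> / S' k \<le> 3 * H / (real d + 1)"
      using Sp by (simp add: pos_divide_le_eq mult_ac)
    then have 1: "\<bar>flow \<delta> (q_dev k) d / S' k\<bar> \<le> 3 * H / (real d + 1)" using Sp by simp
    have "\<bar>\<delta> / S' k * E k (\<lambda>ms. (M ms)\<^sup>2 * r ms d / S ms)\<bar> \<le> \<delta> / S' k * (C * real k * g d)"
      unfolding abs_mult using C(2)[of k d] \<delta> Sp by (intro mult_mono) auto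
    also have "\<dots> \<le> \<delta> / S' k * (C * S' k * (1 / \<delta> * (1 / (real d + 1))))"
      using C(1) \<delta> Sp S'_ge[of k] g_le[of d] gp[of d] by (intro mult_left_mono mult_mono) auto
    also have "\<dots> = C / (real d + 1)" using Sp \<delta> by simp
    finally have "\<bar>E k (\<lambda>ms. M ms * r ms d / S ms)\<bar> \<le> 3 * H / (real d + 1) + C / (real d + 1)"
      unfolding E_r_dev using 1 by linarith
    then have "\<delta> / S' k * \<bar>E k (\<lambda>ms. M ms * r ms d / S ms)\<bar> \<le> \<delta> / S' k * ((3 * H + C) / (real d + 1))"
      using \<delta> Sp by (intro mult_left_mono) (auto simp: add_divide_distrib)
    also have "\<dots> = (3 * \<delta> * H + \<delta> * C) / ((real d + 1) * S' k)" by (simp add: algebra_simps)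
    finally show ?thesis unfolding drift_error_eq abs_mult using \<delta> Sp by simp
  qed
  moreover have "3 * \<delta> * H + \<delta> * C \<ge> 0" using \<delta> H0 C by simp
  ultimately show ?thesis by blast
qed


subsection \<open>Asymptotics of the averaged counts\<close>

text \<open>As \<open>c \<le> 1\<close>, the recursion gives
  \<open>(d + \<delta> + 2) * f (Suc d) \<le> (d + \<delta>) * f d\<close>, so
  \<open>(d + \<delta>) * (d + \<delta> + 1) * f d\<close> does not increase for
  \<open>d \<ge> 1\<close>. Quadratic decay is what keeps \<open>f d * t\<close> of order
  \<open>1 / d\<close> beyond \<open>d = t\<close>, where the counts vanish.\<close>

lemma stationary_decay:
  assumes f: "\<And>d. f d \<ge> 0"
    and f_rec: "\<And>d. f d = (1 - \<gamma>) / \<sigma> * flow \<delta> f d + (\<alpha> * of_bool (d = 0) + \<gamma> * of_bool (d = 1))"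
  shows "\<exists>F\<ge>0. \<forall>d. f d * (real d + 1)\<^sup>2 \<le> F"
proof -
  define c where "c = (1 - \<gamma>) / \<sigma>"
  have c: "0 < c" "c \<le> 1"
    using \<sigma>_gt pos sum_1 by (auto simp: c_def divide_simps)
  define U where "U = (1 + \<delta>) * (2 + \<delta>) * f 1"
  have U: "(real d + \<delta>) * (real d + \<delta> + 1) * f d \<le> U" if "d \<ge> 1" for d
    using that
  proof (induction d rule: nat_induct_at_least)
    case base
    then show ?case by (simp add: U_def add.commute add.left_commute)
  next
    case (Suc d)
    define w where "w = real d + \<delta>"
    have w: "w > 0" using Suc.hyps nonneg by (simp add: w_def add_pos_nonneg)
    have "f (Suc d) = c * (w * f d - (w + 1) * f (Suc d))"
      using f_rec[of "Suc d"] Suc.hyps by (simp add: flow_def w_def c_def algebra_simps)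
    moreover have "c * f (Suc d) \<le> f (Suc d)" using c f[of "Suc d"] mult_right_mono[of c 1] by simp
    ultimately have "c * ((w + 2) * f (Suc d)) \<le> c * (w * f d)" by (simp add: algebra_simps)
    then have "(w + 2) * f (Suc d) \<le> w * f d" using c by simp
    then have "(w + 1) * ((w + 2) * f (Suc d)) \<le> (w + 1) * (w * f d)"
      using w by (intro mult_left_mono) auto
    also have "\<dots> \<le> U" using Suc.IH by (simp add: w_def mult_ac)
    finally show ?case by (simp add: w_def algebra_simps)
  qed
  have U0: "U \<ge> 0" using f[of 1] nonneg by (simp add: U_def)
  have "f d * (real d + 1)\<^sup>2 \<le> f 0 + 2 * U" for d
  proof (cases "d = 0")
    case True
    then show ?thesis using U0 by simp
  next
    case False
    then have "(real d + 1) * (real d + 1) \<le> (2 * (real d + \<delta>)) * (real d + \<delta> + 1)"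
      using nonneg by (intro mult_mono) auto
    then have "f d * (real d + 1)\<^sup>2 \<le> f d * ((2 * (real d + \<delta>)) * (real d + \<delta> + 1))"
      using f by (intro mult_left_mono) (auto simp: power2_eq_square)
    also have "\<dots> = 2 * ((real d + \<delta>) * (real d + \<delta> + 1) * f d)" by simp
    also have "\<dots> \<le> 2 * U" using U[of d] False by simp
    finally show ?thesis using f[of 0] by simp
  qed
  then show ?thesis using f[of 0] U0 by (intro exI[of _ "f 0 + 2 * U"]) auto
qed

lemma E_q_Suc: "E (Suc k) (\<lambda>ms. q ms d) = E k (\<lambda>ms. q ms d) + (1 - \<gamma>) * E k (\<lambda>ms. r ms d / S ms)
   + (\<alpha> * of_bool (d = 0) + \<gamma> * of_bool (d = 1))"
proof -
  let ?b = "\<alpha> * of_bool (d = 0) + \<gamma> * of_bool (d = 1)"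
  have "E (Suc k) (\<lambda>ms. q ms d) = E k (\<lambda>ms. (q ms d + (1 - \<gamma>) * (r ms d / S ms)) + ?b)"
    unfolding avg.simps
  proof (rule avg_cong)
    fix ms
    have "a * (x + y + e) + b * (x + y) + c * (x + f) = (x + (1 - c) * y) + (a * e + c * f)"
      if "b = 1 - a - c" for a b c e f x y :: real
      unfolding that by (simp add: algebra_simps)
    from this[of \<beta> \<alpha> \<gamma> "q ms d" "r ms d / S ms" "of_bool (d = 0)" "of_bool (d = 1)"]
    show "\<alpha> * q (New_Tail # ms) d + \<beta> * q (Old_Ends # ms) d + \<gamma> * q (New_Head # ms) d =
      q ms d + (1 - \<gamma>) * (r ms d / S ms) + ?b"
      using sum_1 by (simp add: q_Cons born_def algebra_simps)
  qed
  then show ?thesis unfolding avg_add avg_cmult by simp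
qed

text \<open>The case distinction only avoids the junk value of \<open>1 / (d + \<delta>)\<close> at \<open>d = \<delta> = 0\<close>.\<close>

definition "profile d = (1 + ln (real d + 1)) / (if d = 0 \<and> \<delta> = 0 then 1 else real d + \<delta>)"

lemma profile_ge: "profile d \<ge> 1 / ((1 + \<delta>) * (real d + 1))"
proof -
  have den: "0 < (if d = 0 \<and> \<delta> = 0 then 1 else real d + \<delta>)"
    using nonneg by (cases "d = 0") (auto simp: add_pos_nonneg)
  have "0 \<le> \<delta> * real d" using nonneg by simp
  then have "(if d = 0 \<and> \<delta> = 0 then 1 else real d + \<delta>) \<le> (1 + \<delta>) * (real d + 1)"
    using nonneg by (auto simp: algebra_simps)
  then have "1 / ((1 + \<delta>) * (real d + 1)) \<le> 1 / (if d = 0 \<and> \<delta> = 0 then 1 else real d + \<delta>)"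
    using den nonneg by (intro divide_left_mono mult_pos_pos) auto
  also have "\<dots> \<le> profile d" unfolding profile_def
    using den by (intro divide_right_mono) auto
  finally show ?thesis .
qed

lemma profile_pos: "profile d > 0"
proof -
  have "0 < 1 / ((1 + \<delta>) * (real d + 1))" using nonneg by (intro divide_pos_pos mult_pos_pos) auto
  then show ?thesis using profile_ge[of d] by linarith
qed

lemma profile_le: "\<exists>C\<ge>0. \<forall>d. profile d \<le> C * ((1 + ln (real d + 1)) / (real d + 1))"
proof -
  define C where "C = 2 + profile 0"
  have C: "C \<ge> 2" using profile_pos[of 0] by (simp add: C_def)
  have "profile d \<le> C * ((1 + ln (real d + 1)) / (real d + 1))" for d
  proof (cases "d = 0")
    case True
    then show ?thesis by (simp add: C_def)
  next
    case False
    have L: "1 + ln (real d + 1) \<ge> 0" by (simp add: add_nonneg_nonneg)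
    have "real d \<ge> 1" using False by simp
    then have d: "(real d + 1) / 2 \<le> real d + \<delta>" using nonneg(4) by simp
    have "profile d = (1 + ln (real d + 1)) / (real d + \<delta>)" using False by (simp add: profile_def)
    also have "\<dots> \<le> (1 + ln (real d + 1)) / ((real d + 1) / 2)"
      using d L False nonneg by (intro divide_left_mono mult_pos_pos) (auto simp: add_pos_nonneg)
    also have "\<dots> = 2 * ((1 + ln (real d + 1)) / (real d + 1))" by simp
    also have "\<dots> \<le> C * ((1 + ln (real d + 1)) / (real d + 1))"
      using C L by (intro mult_right_mono) auto
    finally show ?thesis .
  qed
  then show ?thesis using C by (intro exI[of _ C]) auto
qed

text \<open>For positive \<open>d\<close>,
  \<open>(d + \<delta>) * profile d = 1 + ln (d + 1)\<close>, so the flow is at most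
  \<open>ln d - ln (d + 1)\<close>. The resulting loss of \<open>1 / (d + 1)\<close> matches the
  size of the drift error.\<close>

lemma flow_profile:
  assumes "d > 0 \<or> \<delta> > 0"
  shows "flow \<delta> profile d \<le> - 1 / (real d + 1)"
proof (cases d)
  case 0
  then show ?thesis using assms by (simp add: flow_def profile_def)
next
  case (Suc j)
  \<comment> \<open>Only an inequality: for \<open>d = 1\<close> and \<open>\<delta> = 0\<close> the
    left side is 0 and the right side is 1.\<close>
  have 1: "(real d - 1 + \<delta>) * profile (d - 1) \<le> 1 + ln (real d)"
    using Suc nonneg by (auto simp: profile_def add_nonneg_eq_0_iff)
  have 2: "(real d + \<delta>) * profile d = 1 + ln (real d + 1)"
    using Suc nonneg by (auto simp: profile_def add_nonneg_eq_0_iff)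
  have "ln (real d / (real d + 1)) \<le> real d / (real d + 1) - 1"
    using Suc by (intro ln_le_minus_one) auto
  also have "\<dots> = - 1 / (real d + 1)" by (simp add: field_simps)
  finally have "ln (real d) - ln (real d + 1) \<le> - 1 / (real d + 1)"
    using Suc by (simp add: ln_div)
  then show ?thesis using 1 2 Suc by (simp add: flow_def)
qed

text \<open>The deviation \<open>y\<close> from the stationary solution obeys the homogeneous flow
  step with the drift error as its only source. Since the flow lowers \<open>profile\<close> by
  enough to pay for that source, a bound \<open>H * profile d\<close> with \<open>H \<ge> C\<close>
  persists in time.\<close>

theorem E_q_asymptotics:
  assumes f: "\<And>d. f d \<ge> 0"
    and f_rec: "\<And>d. f d = (1 - \<gamma>) / \<sigma> * flow \<delta> f d + (\<alpha> * of_bool (d = 0) + \<gamma> * of_bool (d = 1))"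
  shows "\<exists>H. \<forall>k d. \<bar>E k (\<lambda>ms. q ms d) - f d * real (t\<^sub>0 + k)\<bar> \<le> H * ((1 + ln (real d + 1)) / (real d + 1))"
proof -
  have g1: "0 \<le> 1 - \<gamma>" "1 - \<gamma> \<le> 1" using sum_1 nonneg by linarith+
  have \<sigma>: "\<sigma> > 0" using \<sigma>_gt g1 by linarith
  obtain F where F: "F \<ge> 0" "\<And>d. f d * (real d + 1)\<^sup>2 \<le> F"
    using stationary_decay[OF f f_rec] by blast
  obtain C where C: "C \<ge> 0" "\<And>k d. \<bar>drift_error k d\<bar> \<le> C / ((real d + 1) * S' k)"
    using drift_error_bounded by blast
  define s where "s k = (1 - \<gamma>) / S' k" for k
  \<comment> \<open>Against \<open>S' k / \<sigma>\<close> instead of the time, the stationary part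
    cancels exactly; the two differ by the constant \<open>b\<close> below.\<close>
  define y where "y k d = E k (\<lambda>ms. q ms d) - f d * S' k / \<sigma>" for k d
  have y_Suc: "y (Suc k) d = y k d + s k * flow \<delta> (y k) d + (1 - \<gamma>) * drift_error k d" for k d
  proof -
    have "flow \<delta> (y k) d = flow \<delta> (\<lambda>d. E k (\<lambda>ms. q ms d)) d - S' k / \<sigma> * flow \<delta> f d"
      unfolding y_def by (subst flow_linear(3)[symmetric]) (simp add: flow_def algebra_simps)
    then have "s k * flow \<delta> (y k) d + (1 - \<gamma>) * drift_error k d
        = (1 - \<gamma>) * E k (\<lambda>ms. r ms d / S ms) - (1 - \<gamma>) / \<sigma> * flow \<delta> f d"
    proof -
      have "(1 - \<gamma>) / p * (a - p / \<sigma> * b) + (1 - \<gamma>) * (e - a / p) = (1 - \<gamma>) * e - (1 - \<gamma>) / \<sigma> * b"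
        if "p > 0" for a b e p
        using that \<sigma> by (simp add: field_simps)
      from this[OF S'_pos] show ?thesis
        using \<open>flow \<delta> (y k) d = _\<close> by (simp only: s_def drift_error_def)
    qed
    moreover have "f d * S' (Suc k) / \<sigma> = f d * S' k / \<sigma> + f d"
      using \<sigma> by (simp add: S'_Suc field_simps)
    ultimately show ?thesis using f_rec[of d] E_q_Suc[of k d] unfolding y_def by linarith
  qed
  obtain k\<^sub>0 where k0: "\<And>k d. k \<ge> k\<^sub>0 \<Longrightarrow> d \<le> t\<^sub>0 + Suc k \<Longrightarrow> s k * (real d + \<delta>) \<le> 1"
    using steps_small unfolding s_def by blast
  define L where "L = 1 + \<delta> * real n\<^sub>0 + \<delta>"
  have L: "L \<ge> 0" using nonneg by (simp add: L_def)
  have S'_le: "S' k \<le> L * (real (t\<^sub>0 + k) + 1)" for k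
  proof -
    have "\<delta> * (\<nu> * real k) \<le> \<delta> * (real (t\<^sub>0 + k) + 1)"
      using nonneg \<nu> mult_right_mono[of \<nu> 1 "real k"] by (intro mult_left_mono) auto
    moreover have "\<delta> * real n\<^sub>0 \<le> \<delta> * real n\<^sub>0 * (real (t\<^sub>0 + k) + 1)"
      using nonneg mult_left_mono[of 1 "real (t\<^sub>0 + k) + 1" "\<delta> * real n\<^sub>0"] by simp
    ultimately show ?thesis by (simp add: L_def mean_weight_def algebra_simps)
  qed
  have "\<exists>H. \<forall>k d. \<bar>y k d\<bar> \<le> H * profile d"
  proof (rule ratio_bounded_by_step[where N = t\<^sub>0 and C = "F * L * (1 + \<delta>) / \<sigma>" and k\<^sub>0 = k\<^sub>0 and H\<^sub>0 = C])
    show "\<bar>y k d\<bar> \<le> F * L * (1 + \<delta>) / \<sigma> * profile d" if "d > t\<^sub>0 + k" for k d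
    proof -
      have "E k (\<lambda>ms. q ms d) = E k (\<lambda>_. 0)" by (rule avg_cong) (use that in \<open>simp add: q_eq_0\<close>)
      then have "\<bar>y k d\<bar> = f d * S' k / \<sigma>" using f[of d] S'_pos[of k] \<sigma> by (simp add: y_def)
      \<comment> \<open>Here \<open>d\<close> exceeds the time, so \<open>S' k\<close> has order
        \<open>d + 1\<close>, and the quadratic decay of \<open>f\<close> leaves order
        \<open>1 / (d + 1)\<close>.\<close>
      also have "f d * S' k \<le> F / (real d + 1)\<^sup>2 * (L * (real d + 1))"
      proof (rule mult_mono)
        show "f d \<le> F / (real d + 1)\<^sup>2" using F(2)[of d] by (simp add: pos_le_divide_eq)
        have "S' k \<le> L * (real (t\<^sub>0 + k) + 1)" by (rule S'_le)
        also have "\<dots> \<le> L * (real d + 1)" using L that by (intro mult_left_mono) auto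
        finally show "S' k \<le> L * (real d + 1)" .
      qed (use S'_pos[of k] F in auto)
      also have "F / (real d + 1)\<^sup>2 * (L * (real d + 1)) = F * L * (1 + \<delta>) * (1 / ((1 + \<delta>) * (real d + 1)))"
        using nonneg by (simp add: power2_eq_square divide_simps add_pos_nonneg)
      also have "\<dots> \<le> F * L * (1 + \<delta>) * profile d"
        using profile_ge[of d] F L nonneg by (intro mult_left_mono) auto
      finally show ?thesis using \<sigma> by (simp add: divide_right_mono)
    qed
    show "\<bar>y (Suc k) d\<bar> \<le> H * profile d"
      if H: "H \<ge> C" and k: "k \<ge> k\<^sub>0" "d \<le> t\<^sub>0 + Suc k" and IH: "\<And>j. \<bar>y k j\<bar> \<le> H * profile j" for H k d
    proof -
      have sp: "s k \<ge> 0" using g1 S'_pos[of k] by (simp add: s_def)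
      have 1: "\<bar>y k d + s k * flow \<delta> (y k) d\<bar> \<le> H * profile d + s k * flow \<delta> (\<lambda>d. H * profile d) d"
        by (rule abs_flow_step_le[OF IH nonneg(4) sp k0[OF k]])
      have "s k * flow \<delta> (\<lambda>d. H * profile d) d + \<bar>(1 - \<gamma>) * drift_error k d\<bar> \<le> 0"
      \<comment> \<open>In this case vertices of in-degree 0 are never hit, so flow and error both
        vanish.\<close>
      proof (cases "d = 0 \<and> \<delta> = 0")
        case True
        then have "flow \<delta> (\<lambda>d. H * profile d) d = 0" by (simp add: flow_def)
        moreover have "drift_error k d = 0" unfolding drift_error_eq using True by simp
        ultimately show ?thesis by simp
      next
        case False
        have "\<bar>(1 - \<gamma>) * drift_error k d\<bar> \<le> (1 - \<gamma>) * (C / ((real d + 1) * S' k))"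
          unfolding abs_mult using C(2)[of k d] g1 by (intro mult_mono) auto
        also have "\<dots> = s k * (C * (1 / (real d + 1)))" by (simp add: s_def)
        also have "\<dots> \<le> s k * (H * (1 / (real d + 1)))"
          using sp H by (intro mult_left_mono mult_right_mono) auto
        finally have "\<bar>(1 - \<gamma>) * drift_error k d\<bar> \<le> s k * (H * (1 / (real d + 1)))" .
        moreover have "flow \<delta> profile d \<le> - (1 / (real d + 1))"
          using flow_profile[of d] False nonneg by auto
        then have "s k * (H * flow \<delta> profile d) \<le> s k * (H * - (1 / (real d + 1)))"
          using sp H C(1) by (intro mult_left_mono) auto
        ultimately show ?thesis by (simp add: flow_linear)
      qed
      then show ?thesis using 1 unfolding y_Suc by linarith
    qed
  qed (rule profile_pos)
  then obtain H where H: "\<And>k d. \<bar>y k d\<bar> \<le> H * profile d" by blast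
  obtain P where P: "P \<ge> 0" "\<And>d. profile d \<le> P * ((1 + ln (real d + 1)) / (real d + 1))"
    using profile_le by blast
  define b where "b = (real t\<^sub>0 + \<delta> * real n\<^sub>0) / \<sigma> - real t\<^sub>0"
  have S'_lin: "S' k / \<sigma> = real (t\<^sub>0 + k) + b" for k
    using \<sigma> by (simp add: b_def mean_weight_def \<sigma>_def field_simps)
  have H0: "H \<ge> 0"
  proof -
    have "0 \<le> H * profile 0" using H[of 0 0] by linarith
    then show ?thesis using profile_pos[of 0] by (metis mult_less_0_iff not_le)
  qed
  have "\<bar>E k (\<lambda>ms. q ms d) - f d * real (t\<^sub>0 + k)\<bar> \<le>
     (H * P + F * \<bar>b\<bar>) * ((1 + ln (real d + 1)) / (real d + 1))" for k d
  proof -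
    let ?l = "(1 + ln (real d + 1)) / (real d + 1)"
    have "f d * (real d + 1) \<le> f d * (real d + 1)\<^sup>2"
      using f[of d] by (intro mult_left_mono) (auto simp: power2_eq_square)
    then have "f d \<le> F * (1 / (real d + 1))" using F(2)[of d] by (simp add: pos_le_divide_eq)
    also have "\<dots> \<le> F * ?l" using F(1) by (intro mult_left_mono divide_right_mono) auto
    finally have "\<bar>f d * b\<bar> \<le> F * ?l * \<bar>b\<bar>"
      unfolding abs_mult using f[of d] by (intro mult_right_mono) auto
    moreover have "H * profile d \<le> H * (P * ?l)" using H0 P(2) by (intro mult_left_mono)
    then have "\<bar>y k d\<bar> \<le> H * (P * ?l)" using H[of k d] by linarith
    moreover have "E k (\<lambda>ms. q ms d) - f d * real (t\<^sub>0 + k) = y k d + f d * b"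
      using S'_lin[of k] by (simp add: y_def algebra_simps flip: times_divide_eq_right)
    ultimately show ?thesis by (simp only: distrib_right mult_ac)
  qed
  then show ?thesis by blast
qed

end

subsection \<open>The graph process conditioned on its moves\<close>

lemma expectation_bind_finite:
  fixes h :: "'b \<Rightarrow> real"
  assumes "finite (set_pmf p)" "\<And>x. x \<in> set_pmf p \<Longrightarrow> finite (set_pmf (f x))"
  shows "measure_pmf.expectation (bind_pmf p f) h
    = measure_pmf.expectation p (\<lambda>x. measure_pmf.expectation (f x) h)"
proof -
  have "measure_pmf.expectation (bind_pmf p f) h
      = (\<Sum>x\<in>set_pmf p. pmf p x *\<^sub>R measure_pmf.expectation (f x) h)"
    using assms by (intro pmf_expectation_bind) auto
  also have "\<dots> = measure_pmf.expectation p (\<lambda>x. measure_pmf.expectation (f x) h)"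
    using assms by (intro integral_measure_pmf[symmetric]) auto
  finally show ?thesis .
qed

lemma expectation_cong_pmf:
  fixes f h :: "'a \<Rightarrow> real"
  assumes "\<And>x. x \<in> set_pmf p \<Longrightarrow> f x = h x"
  shows "measure_pmf.expectation p f = measure_pmf.expectation p h"
  by (intro integral_cong_AE) (use assms in \<open>auto simp: AE_measure_pmf_iff\<close>)

lemma expectation_three_moves:
  fixes h :: "'a \<Rightarrow> real"
  assumes "\<alpha> \<ge> 0" "\<beta> \<ge> 0" "\<gamma> \<ge> 0" "\<alpha> + \<beta> + \<gamma> = 1" "\<And>m. finite (set_pmf (f m))"
  shows "measure_pmf.expectation
      (bind_pmf (pmf_of_list [(New_Tail, \<alpha>), (Old_Ends, \<beta>), (New_Head, \<gamma>)]) f) h =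
    \<alpha> * measure_pmf.expectation (f New_Tail) h + \<beta> * measure_pmf.expectation (f Old_Ends) h
    + \<gamma> * measure_pmf.expectation (f New_Head) h"
proof -
  let ?L = "[(New_Tail, \<alpha>), (Old_Ends, \<beta>), (New_Head, \<gamma>)]"
  have wf: "pmf_of_list_wf ?L"
    using assms by (auto simp: pmf_of_list_wf_def)
  have "measure_pmf.expectation (bind_pmf (pmf_of_list ?L) f) h =
     (\<Sum>m\<in>{New_Tail, Old_Ends, New_Head}. pmf (pmf_of_list ?L) m *\<^sub>R measure_pmf.expectation (f m) h)"
    using assms(5) by (intro pmf_expectation_bind) (auto intro: move.exhaust)
  then show ?thesis by (simp add: pmf_pmf_of_list[OF wf])
qed

definition move_step ::
  "real \<Rightarrow> real \<Rightarrow> move \<Rightarrow> ('a::infinite, 'b::infinite) pre_digraph \<Rightarrow> ('a, 'b) pre_digraph pmf" where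
  "move_step \<delta>\<^sub>i\<^sub>n \<delta>\<^sub>o\<^sub>u\<^sub>t m G = (case m of
       New_Tail \<Rightarrow> map_pmf (\<lambda>w. add_edge (new_vertex G) w G) (pick_in \<delta>\<^sub>i\<^sub>n G)
     | Old_Ends \<Rightarrow>
         map_pmf (\<lambda>(v, w). add_edge v w G) (pair_pmf (pick_out \<delta>\<^sub>o\<^sub>u\<^sub>t G) (pick_in \<delta>\<^sub>i\<^sub>n G))
     | New_Head \<Rightarrow> map_pmf (\<lambda>v. add_edge v (new_vertex G) G) (pick_out \<delta>\<^sub>o\<^sub>u\<^sub>t G))"

lemma graph_step_eq: "graph_step \<alpha> \<beta> \<gamma> \<delta>\<^sub>i\<^sub>n \<delta>\<^sub>o\<^sub>u\<^sub>t G =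
  bind_pmf (pmf_of_list [(New_Tail, \<alpha>), (Old_Ends, \<beta>), (New_Head, \<gamma>)]) (\<lambda>m. move_step \<delta>\<^sub>i\<^sub>n \<delta>\<^sub>o\<^sub>u\<^sub>t m G)"
  unfolding graph_step_def move_step_def ..

text \<open>The conditional law of the graph given its moves, built move by move instead of by
  conditioning, so that moves of probability 0 cause no exception.\<close>

primrec graph_given :: "real \<Rightarrow> real \<Rightarrow> ('a::infinite, 'b::infinite) pre_digraph
     \<Rightarrow> move list \<Rightarrow> ('a, 'b) pre_digraph pmf" where
  "graph_given \<delta>\<^sub>i\<^sub>n \<delta>\<^sub>o\<^sub>u\<^sub>t G [] = return_pmf G"
| "graph_given \<delta>\<^sub>i\<^sub>n \<delta>\<^sub>o\<^sub>u\<^sub>t G (m # ms) =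
     bind_pmf (graph_given \<delta>\<^sub>i\<^sub>n \<delta>\<^sub>o\<^sub>u\<^sub>t G ms) (move_step \<delta>\<^sub>i\<^sub>n \<delta>\<^sub>o\<^sub>u\<^sub>t m)"

lemma new_vertex_notin: "finite (verts G) \<Longrightarrow> new_vertex G \<notin> verts G"
  unfolding new_vertex_def by (rule someI_ex) (simp add: arb_element)

section \<open>Effect of one new edge on the in-degree counts\<close>

lemma in_degree_add_edge:
  fixes G :: "('a, 'b::infinite) pre_digraph"
  assumes "fin_digraph G"
  shows "in_degree (add_edge v w G) u = in_degree G u + of_bool (u = w)"
proof -
  interpret fin_digraph G by fact
  have new: "new_arc G \<notin> arcs G" unfolding new_arc_def by (rule someI_ex) (simp add: arb_element)
  then have "in_arcs (add_edge v w G) u = (if u = w then insert (new_arc G) (in_arcs G u) else in_arcs G u)"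
    by (auto simp: in_arcs_def add_edge_def)
  moreover have "card (insert (new_arc G) (in_arcs G u)) = Suc (card (in_arcs G u))"
    by (rule card_insert_disjoint) (use new in \<open>auto simp: in_arcs_def\<close>)
  ultimately show ?thesis by (cases "u = w") (simp_all add: in_degree_def)
qed

lemma in_degree_not_vert:
  assumes "fin_digraph G" "u \<notin> verts G"
  shows "in_degree G u = 0"
proof -
  interpret fin_digraph G by fact
  have "in_arcs G u = {}" using assms(2) by (auto simp: in_arcs_def)
  then show ?thesis by (simp add: in_degree_def)
qed

lemma n_in_eq_sum: "finite (verts G) \<Longrightarrow> real (n_in G d) = (\<Sum>u\<in>verts G. of_bool (in_degree G u = d))"
  by (simp add: n_in_def sum.If_cases of_bool_def Int_def)

text \<open>An existing head leaves its degree class for the next one, and a new tail enters class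
  0. A new head enters class 1 directly.\<close>

lemma n_in_add_edge:
  fixes G :: "('a, 'b::infinite) pre_digraph"
  assumes G: "fin_digraph G"
  shows "w \<in> verts G \<Longrightarrow> real (n_in (add_edge v w G) d) = real (n_in G d)
      + (of_bool (Suc (in_degree G w) = d) - of_bool (in_degree G w = d)) + of_bool (v \<notin> verts G \<and> d = 0)"
    and "v \<in> verts G \<Longrightarrow> w \<notin> verts G \<Longrightarrow>
      real (n_in (add_edge v w G) d) = real (n_in G d) + of_bool (d = 1)"
proof -
  interpret fin_digraph G by fact
  let ?h = "\<lambda>u. of_bool (in_degree G u + of_bool (u = w) = d) :: real"
  have fin: "finite (verts (add_edge v w G))" by (simp add: add_edge_def)
  have eq: "real (n_in (add_edge v w G) d) = (\<Sum>u\<in>insert v (insert w (verts G)). ?h u)"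
    unfolding n_in_eq_sum[OF fin] in_degree_add_edge[OF G] by (simp add: add_edge_def)
  {
    assume w: "w \<in> verts G"
    have "(\<Sum>u\<in>verts G. ?h u) = ?h w + (\<Sum>u\<in>verts G - {w}. of_bool (in_degree G u = d))"
      using w by (subst sum.remove[of _ w]) (auto intro!: sum.cong)
    moreover have "real (n_in G d) = of_bool (in_degree G w = d) + (\<Sum>u\<in>verts G - {w}. of_bool (in_degree G u = d))"
      by (simp only: n_in_eq_sum[OF finite_verts] sum.remove[OF finite_verts w])
    moreover have "(\<Sum>u\<in>insert v (insert w (verts G)). ?h u) = (\<Sum>u\<in>verts G. ?h u) + of_bool (v \<notin> verts G \<and> d = 0)"
    proof (cases "v \<in> verts G")
      case False
      then have "v \<noteq> w" "in_degree G v = 0" using w in_degree_not_vert[OF G] by auto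
      then show ?thesis using w False by (simp add: insert_absorb)
    qed (use w in \<open>simp add: insert_absorb\<close>)
    ultimately show "real (n_in (add_edge v w G) d) = real (n_in G d)
      + (of_bool (Suc (in_degree G w) = d) - of_bool (in_degree G w = d)) + of_bool (v \<notin> verts G \<and> d = 0)"
      unfolding eq by simp
  next
    assume vw: "v \<in> verts G" "w \<notin> verts G"
    then have "(\<Sum>u\<in>insert v (insert w (verts G)). ?h u) = ?h w + (\<Sum>u\<in>verts G. ?h u)"
      by (simp add: insert_absorb)
    also have "(\<Sum>u\<in>verts G. ?h u) = real (n_in G d)"
      unfolding n_in_eq_sum[OF finite_verts] using vw by (intro sum.cong) auto
    also have "?h w = of_bool (d = 1)" using in_degree_not_vert[OF G vw(2)] by auto
    finally show "real (n_in (add_edge v w G) d) = real (n_in G d) + of_bool (d = 1)" using eq by simp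
  }
qed

text \<open>The condition under which both vertex choices are genuine probability distributions. It
  is preserved by every step, because a graph with at least one arc has positive
  denominators.\<close>

locale attachable = fin_digraph G
  for G :: "('a::infinite, 'b::infinite) pre_digraph" +
  fixes \<delta>\<^sub>i\<^sub>n \<delta>\<^sub>o\<^sub>u\<^sub>t :: real
  assumes \<delta>_nonneg: "\<delta>\<^sub>i\<^sub>n \<ge> 0" "\<delta>\<^sub>o\<^sub>u\<^sub>t \<ge> 0"
    and in_pos: "real (card (arcs G)) + \<delta>\<^sub>i\<^sub>n * real (card (verts G)) > 0"
    and out_pos: "real (card (arcs G)) + \<delta>\<^sub>o\<^sub>u\<^sub>t * real (card (verts G)) > 0"
begin

lemma set_pick_in: "set_pmf (pick_in \<delta>\<^sub>i\<^sub>n G) \<subseteq> verts G"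
  using pmf_pick_in[OF \<delta>_nonneg(1) in_pos] by (auto simp: set_pmf_iff split: if_splits)

lemma set_pick_out: "set_pmf (pick_out \<delta>\<^sub>o\<^sub>u\<^sub>t G) \<subseteq> verts G"
  using pmf_pick_out[OF \<delta>_nonneg(2) out_pos] by (auto simp: set_pmf_iff split: if_splits)

lemma finite_set_move_step: "finite (set_pmf (move_step \<delta>\<^sub>i\<^sub>n \<delta>\<^sub>o\<^sub>u\<^sub>t m G))"
  using finite_subset[OF set_pick_in] finite_subset[OF set_pick_out]
  by (cases m) (auto simp: move_step_def)

lemma move_step_cards:
  assumes "H \<in> set_pmf (move_step \<delta>\<^sub>i\<^sub>n \<delta>\<^sub>o\<^sub>u\<^sub>t m G)"
  shows "attachable H \<delta>\<^sub>i\<^sub>n \<delta>\<^sub>o\<^sub>u\<^sub>t" "card (arcs H) = Suc (card (arcs G))"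
    "card (verts H) = card (verts G) + (if m = Old_Ends then 0 else 1)"
proof -
  have new: "new_vertex G \<notin> verts G" by (simp add: new_vertex_notin)
  obtain v w where H: "H = add_edge v w G" and vw: "if m = New_Tail then v = new_vertex G \<and> w \<in> verts G
      else if m = New_Head then w = new_vertex G \<and> v \<in> verts G else v \<in> verts G \<and> w \<in> verts G"
    using assms set_pick_in set_pick_out by (cases m) (auto simp: move_step_def)
  have fin: "fin_digraph H" unfolding H by (rule fin_digraph_add_edge) unfold_locales
  show arcs: "card (arcs H) = Suc (card (arcs G))" unfolding H by (rule fin_digraph_add_edge) unfold_locales
  show "card (verts H) = card (verts G) + (if m = Old_Ends then 0 else 1)"
    using vw new by (cases m) (auto simp: H add_edge_def insert_absorb)
  interpret H: fin_digraph H by fact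
  show "attachable H \<delta>\<^sub>i\<^sub>n \<delta>\<^sub>o\<^sub>u\<^sub>t"
    by unfold_locales (use \<delta>_nonneg in \<open>simp_all add: arcs add_pos_nonneg\<close>)
qed

text \<open>Only vertices of degree \<open>d - 1\<close> and \<open>d\<close> contribute, with signs
  plus and minus; on each class the weight is constant, so the sum collapses to counts.\<close>

lemma expectation_pick_in:
  "measure_pmf.expectation (pick_in \<delta>\<^sub>i\<^sub>n G)
     (\<lambda>w. of_bool (Suc (in_degree G w) = d) - of_bool (in_degree G w = d)) =
   flow \<delta>\<^sub>i\<^sub>n (\<lambda>d. real (n_in G d)) d / (real (card (arcs G)) + \<delta>\<^sub>i\<^sub>n * real (card (verts G)))"
proof -
  let ?S = "real (card (arcs G)) + \<delta>\<^sub>i\<^sub>n * real (card (verts G))"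
  have "measure_pmf.expectation (pick_in \<delta>\<^sub>i\<^sub>n G) (\<lambda>w. of_bool (Suc (in_degree G w) = d) - of_bool (in_degree G w = d) :: real)
     = (\<Sum>w\<in>verts G. pmf (pick_in \<delta>\<^sub>i\<^sub>n G) w *\<^sub>R (of_bool (Suc (in_degree G w) = d) - of_bool (in_degree G w = d)))"
    using set_pick_in by (intro integral_measure_pmf) auto
  also have "\<dots> = (\<Sum>w\<in>verts G. (real (in_degree G w) + \<delta>\<^sub>i\<^sub>n) *
       (of_bool (Suc (in_degree G w) = d) - of_bool (in_degree G w = d))) / ?S"
    unfolding sum_divide_distrib by (intro sum.cong) (auto simp: pmf_pick_in[OF \<delta>_nonneg(1) in_pos])
  also have "(\<Sum>w\<in>verts G. (real (in_degree G w) + \<delta>\<^sub>i\<^sub>n) *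
       (of_bool (Suc (in_degree G w) = d) - of_bool (in_degree G w = d)))
     = (\<Sum>w\<in>verts G. (if d = 0 then 0 else (real d - 1 + \<delta>\<^sub>i\<^sub>n) * of_bool (in_degree G w = d - 1))
          - (real d + \<delta>\<^sub>i\<^sub>n) * of_bool (in_degree G w = d))"
    by (intro sum.cong) auto
  also have "\<dots> = flow \<delta>\<^sub>i\<^sub>n (\<lambda>d. real (n_in G d)) d"
    by (auto simp: flow_def sum_subtractf n_in_eq_sum simp flip: sum_distrib_left)
  finally show ?thesis .
qed

text \<open>The counts see only the head of the new edge. It is drawn by \<open>pick_in\<close>
  under \<open>New_Tail\<close> and \<open>Old_Ends\<close>; under \<open>New_Head\<close> the
  change is the same whichever tail is drawn.\<close>

lemma expectation_move_step:
  "measure_pmf.expectation (move_step \<delta>\<^sub>i\<^sub>n \<delta>\<^sub>o\<^sub>u\<^sub>t m G) (\<lambda>H. real (n_in H d)) =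
   real (n_in G d) + hits_old m / (real (card (arcs G)) + \<delta>\<^sub>i\<^sub>n * real (card (verts G)))
     * flow \<delta>\<^sub>i\<^sub>n (\<lambda>d. real (n_in G d)) d + born m d"
proof -
  have G: "fin_digraph G" by unfold_locales
  have new: "new_vertex G \<notin> verts G" by (simp add: new_vertex_notin)
  let ?I = "\<lambda>w. of_bool (Suc (in_degree G w) = d) - of_bool (in_degree G w = d) :: real"
  have int: "integrable (measure_pmf (pick_in \<delta>\<^sub>i\<^sub>n G)) h" for h :: "'a \<Rightarrow> real"
    using finite_subset[OF set_pick_in] by (intro integrable_measure_pmf_finite) auto
  show ?thesis
  proof (cases m)
    case New_Tail
    have "measure_pmf.expectation (move_step \<delta>\<^sub>i\<^sub>n \<delta>\<^sub>o\<^sub>u\<^sub>t m G) (\<lambda>H. real (n_in H d)) =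
      measure_pmf.expectation (pick_in \<delta>\<^sub>i\<^sub>n G) (\<lambda>w. real (n_in (add_edge (new_vertex G) w G) d))"
      by (simp add: New_Tail move_step_def)
    also have "\<dots> = measure_pmf.expectation (pick_in \<delta>\<^sub>i\<^sub>n G) (\<lambda>w. real (n_in G d) + ?I w + of_bool (d = 0))"
      by (rule expectation_cong_pmf) (simp add: n_in_add_edge(1)[OF G subsetD[OF set_pick_in]] new)
    also have "\<dots> = real (n_in G d) + measure_pmf.expectation (pick_in \<delta>\<^sub>i\<^sub>n G) ?I + of_bool (d = 0)"
      by (simp add: int del: Bochner_Integration.integral_diff)
    finally show ?thesis by (simp add: expectation_pick_in New_Tail born_def)
  next
    case Old_Ends
    have "measure_pmf.expectation (move_step \<delta>\<^sub>i\<^sub>n \<delta>\<^sub>o\<^sub>u\<^sub>t m G) (\<lambda>H. real (n_in H d)) =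
      measure_pmf.expectation (pair_pmf (pick_out \<delta>\<^sub>o\<^sub>u\<^sub>t G) (pick_in \<delta>\<^sub>i\<^sub>n G))
        (\<lambda>x. real (n_in (add_edge (fst x) (snd x) G) d))"
      by (simp add: Old_Ends move_step_def case_prod_beta)
    also have "\<dots> = measure_pmf.expectation (pair_pmf (pick_out \<delta>\<^sub>o\<^sub>u\<^sub>t G) (pick_in \<delta>\<^sub>i\<^sub>n G))
        (\<lambda>x. real (n_in G d) + ?I (snd x))"
    proof (rule expectation_cong_pmf)
      fix x assume "x \<in> set_pmf (pair_pmf (pick_out \<delta>\<^sub>o\<^sub>u\<^sub>t G) (pick_in \<delta>\<^sub>i\<^sub>n G))"
      then have "fst x \<in> verts G" "snd x \<in> verts G" using set_pick_in set_pick_out by auto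
      then show "real (n_in (add_edge (fst x) (snd x) G) d) = real (n_in G d) + ?I (snd x)"
        using n_in_add_edge(1)[OF G, of "snd x" "fst x" d] by simp
    qed
    \<comment> \<open>The integrand depends on the head alone, so the marginal law suffices.\<close>
    also have "\<dots> = measure_pmf.expectation (map_pmf snd (pair_pmf (pick_out \<delta>\<^sub>o\<^sub>u\<^sub>t G) (pick_in \<delta>\<^sub>i\<^sub>n G)))
        (\<lambda>w. real (n_in G d) + ?I w)"
      by (simp only: integral_map_pmf)
    also have "\<dots> = real (n_in G d) + measure_pmf.expectation (pick_in \<delta>\<^sub>i\<^sub>n G) ?I"
      by (simp add: map_snd_pair_pmf int del: Bochner_Integration.integral_diff)
    finally show ?thesis by (simp add: expectation_pick_in Old_Ends born_def)
  next
    case New_Head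
    have "measure_pmf.expectation (move_step \<delta>\<^sub>i\<^sub>n \<delta>\<^sub>o\<^sub>u\<^sub>t m G) (\<lambda>H. real (n_in H d)) =
      measure_pmf.expectation (pick_out \<delta>\<^sub>o\<^sub>u\<^sub>t G) (\<lambda>v. real (n_in (add_edge v (new_vertex G) G) d))"
      by (simp add: New_Head move_step_def)
    also have "\<dots> = measure_pmf.expectation (pick_out \<delta>\<^sub>o\<^sub>u\<^sub>t G) (\<lambda>_. real (n_in G d) + of_bool (d = 1))"
      by (rule expectation_cong_pmf) (simp add: n_in_add_edge(2)[OF G subsetD[OF set_pick_out] new])
    finally show ?thesis by (simp add: New_Head born_def)
  qed
qed

section \<open>Separation of the moves from the choice of vertices\<close>

lemma graph_given_cards:
  "finite (set_pmf (graph_given \<delta>\<^sub>i\<^sub>n \<delta>\<^sub>o\<^sub>u\<^sub>t G ms)) \<and>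
   (\<forall>H\<in>set_pmf (graph_given \<delta>\<^sub>i\<^sub>n \<delta>\<^sub>o\<^sub>u\<^sub>t G ms). attachable H \<delta>\<^sub>i\<^sub>n \<delta>\<^sub>o\<^sub>u\<^sub>t \<and>
      card (arcs H) = card (arcs G) + length ms \<and> card (verts H) = vertex_count (card (verts G)) ms)"
proof (induction ms)
  case Nil
  have "attachable G \<delta>\<^sub>i\<^sub>n \<delta>\<^sub>o\<^sub>u\<^sub>t" by unfold_locales
  then show ?case by simp
next
  case (Cons m ms)
  then show ?case
    by (auto simp: attachable.finite_set_move_step attachable.move_step_cards)
qed

lemma graph_after_attachable:
  assumes "\<alpha> \<ge> 0" "\<beta> \<ge> 0" "\<gamma> \<ge> 0" "\<alpha> + \<beta> + \<gamma> = 1"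
  shows "finite (set_pmf (graph_after \<alpha> \<beta> \<gamma> \<delta>\<^sub>i\<^sub>n \<delta>\<^sub>o\<^sub>u\<^sub>t G k)) \<and>
    (\<forall>H\<in>set_pmf (graph_after \<alpha> \<beta> \<gamma> \<delta>\<^sub>i\<^sub>n \<delta>\<^sub>o\<^sub>u\<^sub>t G k). attachable H \<delta>\<^sub>i\<^sub>n \<delta>\<^sub>o\<^sub>u\<^sub>t)"
proof (induction k)
  case 0
  have "attachable G \<delta>\<^sub>i\<^sub>n \<delta>\<^sub>o\<^sub>u\<^sub>t" by unfold_locales
  then show ?case by simp
next
  case (Suc k)
  have "finite (UNIV :: move set)"
    by (rule finite_subset[of _ "{New_Tail, Old_Ends, New_Head}"]) (auto intro: move.exhaust)
  then have "finite (set_pmf p)" for p :: "move pmf" by (rule rev_finite_subset) simp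
  then show ?case using Suc
    by (auto simp: graph_step_eq attachable.finite_set_move_step attachable.move_step_cards)
qed

text \<open>The last step turns \<open>h\<close> into a new test function, its average over the
  latest move, just as \<open>avg\<close> treats the head of the list. Hence the induction with
  \<open>h\<close> arbitrary.\<close>

lemma expectation_graph_after:
  fixes h :: "('a, 'b) pre_digraph \<Rightarrow> real"
  assumes par: "\<alpha> \<ge> 0" "\<beta> \<ge> 0" "\<gamma> \<ge> 0" "\<alpha> + \<beta> + \<gamma> = 1"
  shows "measure_pmf.expectation (graph_after \<alpha> \<beta> \<gamma> \<delta>\<^sub>i\<^sub>n \<delta>\<^sub>o\<^sub>u\<^sub>t G k) h =
    avg \<alpha> \<beta> \<gamma> k (\<lambda>ms. measure_pmf.expectation (graph_given \<delta>\<^sub>i\<^sub>n \<delta>\<^sub>o\<^sub>u\<^sub>t G ms) h)"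
proof (induction k arbitrary: h)
  case (Suc k)
  let ?e = "\<lambda>m H. measure_pmf.expectation (move_step \<delta>\<^sub>i\<^sub>n \<delta>\<^sub>o\<^sub>u\<^sub>t m H) h"
  note after = graph_after_attachable[OF par, of k]
  have step: "measure_pmf.expectation (graph_step \<alpha> \<beta> \<gamma> \<delta>\<^sub>i\<^sub>n \<delta>\<^sub>o\<^sub>u\<^sub>t H) h
      = \<alpha> * ?e New_Tail H + \<beta> * ?e Old_Ends H + \<gamma> * ?e New_Head H"
    if "attachable H \<delta>\<^sub>i\<^sub>n \<delta>\<^sub>o\<^sub>u\<^sub>t" for H
    unfolding graph_step_eq
    by (intro expectation_three_moves par attachable.finite_set_move_step that)
  have fin: "finite (set_pmf (graph_step \<alpha> \<beta> \<gamma> \<delta>\<^sub>i\<^sub>n \<delta>\<^sub>o\<^sub>u\<^sub>t H))" if "attachable H \<delta>\<^sub>i\<^sub>n \<delta>\<^sub>o\<^sub>u\<^sub>t" for H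
    using attachable.graph_after_attachable[OF that par, of 1] by (simp add: bind_return_pmf)
  have "measure_pmf.expectation (graph_after \<alpha> \<beta> \<gamma> \<delta>\<^sub>i\<^sub>n \<delta>\<^sub>o\<^sub>u\<^sub>t G (Suc k)) h =
     measure_pmf.expectation (graph_after \<alpha> \<beta> \<gamma> \<delta>\<^sub>i\<^sub>n \<delta>\<^sub>o\<^sub>u\<^sub>t G k)
       (\<lambda>H. measure_pmf.expectation (graph_step \<alpha> \<beta> \<gamma> \<delta>\<^sub>i\<^sub>n \<delta>\<^sub>o\<^sub>u\<^sub>t H) h)"
    unfolding graph_after.simps using after fin by (intro expectation_bind_finite) auto
  also have "\<dots> = measure_pmf.expectation (graph_after \<alpha> \<beta> \<gamma> \<delta>\<^sub>i\<^sub>n \<delta>\<^sub>o\<^sub>u\<^sub>t G k)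
       (\<lambda>H. \<alpha> * ?e New_Tail H + \<beta> * ?e Old_Ends H + \<gamma> * ?e New_Head H)"
    by (rule expectation_cong_pmf) (use step after in blast)
  also have "\<dots> = avg \<alpha> \<beta> \<gamma> k (\<lambda>ms. measure_pmf.expectation (graph_given \<delta>\<^sub>i\<^sub>n \<delta>\<^sub>o\<^sub>u\<^sub>t G ms)
       (\<lambda>H. \<alpha> * ?e New_Tail H + \<beta> * ?e Old_Ends H + \<gamma> * ?e New_Head H))"
    by (rule Suc.IH)
  also have "\<dots> = avg \<alpha> \<beta> \<gamma> (Suc k) (\<lambda>ms. measure_pmf.expectation (graph_given \<delta>\<^sub>i\<^sub>n \<delta>\<^sub>o\<^sub>u\<^sub>t G ms) h)"
    unfolding avg.simps
  proof (rule avg_cong)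
    fix ms
    note given = graph_given_cards[of ms]
    have "measure_pmf.expectation (graph_given \<delta>\<^sub>i\<^sub>n \<delta>\<^sub>o\<^sub>u\<^sub>t G (m # ms)) h
      = measure_pmf.expectation (graph_given \<delta>\<^sub>i\<^sub>n \<delta>\<^sub>o\<^sub>u\<^sub>t G ms) (?e m)" for m
      unfolding graph_given.simps
      using given by (intro expectation_bind_finite) (auto intro: attachable.finite_set_move_step)
    moreover have "integrable (measure_pmf (graph_given \<delta>\<^sub>i\<^sub>n \<delta>\<^sub>o\<^sub>u\<^sub>t G ms)) u"
      for u :: "('a, 'b) pre_digraph \<Rightarrow> real"
      using given by (intro integrable_measure_pmf_finite) auto
    ultimately show "measure_pmf.expectation (graph_given \<delta>\<^sub>i\<^sub>n \<delta>\<^sub>o\<^sub>u\<^sub>t G ms)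
       (\<lambda>H. \<alpha> * ?e New_Tail H + \<beta> * ?e Old_Ends H + \<gamma> * ?e New_Head H) =
      \<alpha> * measure_pmf.expectation (graph_given \<delta>\<^sub>i\<^sub>n \<delta>\<^sub>o\<^sub>u\<^sub>t G (New_Tail # ms)) h
      + \<beta> * measure_pmf.expectation (graph_given \<delta>\<^sub>i\<^sub>n \<delta>\<^sub>o\<^sub>u\<^sub>t G (Old_Ends # ms)) h
      + \<gamma> * measure_pmf.expectation (graph_given \<delta>\<^sub>i\<^sub>n \<delta>\<^sub>o\<^sub>u\<^sub>t G (New_Head # ms)) h"
      by simp
  qed
  finally show ?case .
qed simp

lemma in_degree_counts_given:
  assumes "\<alpha> \<ge> 0" "\<beta> \<ge> 0" "\<gamma> \<ge> 0" "\<alpha> + \<beta> + \<gamma> = 1" "\<alpha> + \<gamma> > 0" "\<alpha> + \<beta> > 0" "\<gamma> + \<delta>\<^sub>i\<^sub>n > 0"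
    and "verts G \<noteq> {}"
  shows "in_degree_counts \<alpha> \<beta> \<gamma> \<delta>\<^sub>i\<^sub>n (card (arcs G)) (card (verts G))
    (\<lambda>ms d. measure_pmf.expectation (graph_given \<delta>\<^sub>i\<^sub>n \<delta>\<^sub>o\<^sub>u\<^sub>t G ms) (\<lambda>H. real (n_in H d)))"
proof
  have fin: "finite (set_pmf (graph_given \<delta>\<^sub>i\<^sub>n \<delta>\<^sub>o\<^sub>u\<^sub>t G ms))" for ms
    using graph_given_cards by blast
  have int: "integrable (measure_pmf (graph_given \<delta>\<^sub>i\<^sub>n \<delta>\<^sub>o\<^sub>u\<^sub>t G ms)) u"
    for ms and u :: "('a, 'b) pre_digraph \<Rightarrow> real"
    by (intro integrable_measure_pmf_finite fin)
  fix ms d m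
  let ?q = "\<lambda>ms d. measure_pmf.expectation (graph_given \<delta>\<^sub>i\<^sub>n \<delta>\<^sub>o\<^sub>u\<^sub>t G ms) (\<lambda>H. real (n_in H d))"
  show "?q ms d \<ge> 0" by simp
  have "n_in H d \<le> vertex_count (card (verts G)) ms" if "H \<in> set_pmf (graph_given \<delta>\<^sub>i\<^sub>n \<delta>\<^sub>o\<^sub>u\<^sub>t G ms)" for H
  proof -
    interpret H: attachable H \<delta>\<^sub>i\<^sub>n \<delta>\<^sub>o\<^sub>u\<^sub>t using that graph_given_cards by blast
    have "n_in H d \<le> card (verts H)" unfolding n_in_def by (rule card_mono) auto
    then show ?thesis using that graph_given_cards[of ms] by auto
  qed
  then have "?q ms d \<le> measure_pmf.expectation (graph_given \<delta>\<^sub>i\<^sub>n \<delta>\<^sub>o\<^sub>u\<^sub>t G ms) (\<lambda>_. real (vertex_count (card (verts G)) ms))"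
    by (intro integral_mono_AE int) (auto simp: AE_measure_pmf_iff)
  then show "?q ms d \<le> real (vertex_count (card (verts G)) ms)" by simp
  show "?q ms d = 0" if d: "d > card (arcs G) + length ms"
  proof -
    have "n_in H d = 0" if H: "H \<in> set_pmf (graph_given \<delta>\<^sub>i\<^sub>n \<delta>\<^sub>o\<^sub>u\<^sub>t G ms)" for H
    proof -
      interpret H: attachable H \<delta>\<^sub>i\<^sub>n \<delta>\<^sub>o\<^sub>u\<^sub>t using H graph_given_cards by blast
      have "in_degree H v \<le> card (arcs H)" for v
        unfolding in_degree_def by (rule card_mono) (auto simp: in_arcs_def)
      also have "card (arcs H) < d" using H d graph_given_cards[of ms] by simp
      finally have "in_degree H v \<noteq> d" for v by (metis less_irrefl)
      then show ?thesis by (simp add: n_in_def)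
    qed
    then have "?q ms d = measure_pmf.expectation (graph_given \<delta>\<^sub>i\<^sub>n \<delta>\<^sub>o\<^sub>u\<^sub>t G ms) (\<lambda>_. 0)"
      by (intro expectation_cong_pmf) simp
    then show ?thesis by simp
  qed
  let ?s = "hits_old m / in_weight \<delta>\<^sub>i\<^sub>n (card (arcs G)) (card (verts G)) ms"
  have "?q (m # ms) d = measure_pmf.expectation (graph_given \<delta>\<^sub>i\<^sub>n \<delta>\<^sub>o\<^sub>u\<^sub>t G ms)
      (\<lambda>H. measure_pmf.expectation (move_step \<delta>\<^sub>i\<^sub>n \<delta>\<^sub>o\<^sub>u\<^sub>t m H) (\<lambda>H. real (n_in H d)))"
    unfolding graph_given.simps using graph_given_cards[of ms]
    by (intro expectation_bind_finite) (auto intro: attachable.finite_set_move_step)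
  also have "\<dots> = measure_pmf.expectation (graph_given \<delta>\<^sub>i\<^sub>n \<delta>\<^sub>o\<^sub>u\<^sub>t G ms)
      (\<lambda>H. real (n_in H d) + ?s * flow \<delta>\<^sub>i\<^sub>n (\<lambda>d. real (n_in H d)) d + born m d)"
    \<comment> \<open>Given the moves, the numbers of arcs and vertices are constant on the support,
      so the denominator is \<open>in_weight\<close>.\<close>
    by (rule expectation_cong_pmf)
      (use graph_given_cards[of ms] in \<open>auto simp: attachable.expectation_move_step in_weight_def\<close>)
  also have "\<dots> = ?q ms d + ?s * measure_pmf.expectation (graph_given \<delta>\<^sub>i\<^sub>n \<delta>\<^sub>o\<^sub>u\<^sub>t G ms)
      (\<lambda>H. flow \<delta>\<^sub>i\<^sub>n (\<lambda>d. real (n_in H d)) d) + born m d"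
    by (simp add: int)
  also have "measure_pmf.expectation (graph_given \<delta>\<^sub>i\<^sub>n \<delta>\<^sub>o\<^sub>u\<^sub>t G ms) (\<lambda>H. flow \<delta>\<^sub>i\<^sub>n (\<lambda>d. real (n_in H d)) d)
      = flow \<delta>\<^sub>i\<^sub>n (?q ms) d"
    by (simp add: flow_def int)
  finally show "?q (m # ms) d = ?q ms d + ?s * flow \<delta>\<^sub>i\<^sub>n (?q ms) d + born m d" .
next
  show "card (verts G) \<ge> 1" using assms by (simp add: Suc_le_eq card_gt_0_iff)
qed (use assms \<delta>_nonneg in_pos in auto)

end

subsection \<open>The limiting degree distribution\<close>

text \<open>The last assumption says precisely that \<open>c_in < 1\<close>, on which the sign of
  \<open>C_in\<close> depends.\<close>

lemma f_in_nonneg: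
  assumes "\<alpha> \<ge> 0" "0 \<le> \<gamma>" "\<gamma> < 1" "\<delta> \<ge> 0" "\<gamma> + \<delta> * (\<alpha> + \<gamma>) > 0"
  shows "f_in \<alpha> \<gamma> \<delta> d \<ge> 0"
proof -
  define c where "c = c_in \<alpha> \<gamma> \<delta>"
  have s: "1 + \<delta> * (\<alpha> + \<gamma>) > 0" using assms by (simp add: add_pos_nonneg)
  have c: "0 < c" "c < 1" using assms s by (auto simp: c_def c_in_def pos_divide_less_eq)
  have "C_in \<alpha> \<gamma> \<delta> \<ge> 0"
    unfolding C_in_def Let_def c_def[symmetric] using c assms
    by (intro mult_nonneg_nonneg divide_nonneg_nonneg less_imp_le[OF Gamma_real_pos]) (auto simp: add_nonneg_pos)
  then show ?thesis
    unfolding f_in_def Let_def c_def[symmetric] using c assms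
    by (auto intro!: mult_nonneg_nonneg divide_nonneg_nonneg less_imp_le[OF Gamma_real_pos] simp: add_pos_nonneg add_nonneg_nonneg)
qed

text \<open>For \<open>d \<ge> 2\<close> the functional equation of \<open>Gamma\<close> gives
  \<open>f d * (d + \<delta> + 1 / c) = (d - 1 + \<delta>) * f (d - 1)\<close>. The case
  \<open>d = 1\<close> is where the normalisation \<open>C_in\<close> is checked against
  \<open>f 0\<close>.\<close>

lemma f_in_rec:
  assumes "\<alpha> \<ge> 0" "0 \<le> \<gamma>" "\<gamma> < 1" "\<delta> \<ge> 0"
  shows "f_in \<alpha> \<gamma> \<delta> d = c_in \<alpha> \<gamma> \<delta> * flow \<delta> (f_in \<alpha> \<gamma> \<delta>) d + (\<alpha> * of_bool (d = 0) + \<gamma> * of_bool (d = 1))"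
proof -
  define c where "c = c_in \<alpha> \<gamma> \<delta>"
  have s: "1 + \<delta> * (\<alpha> + \<gamma>) > 0" using assms by (simp add: add_pos_nonneg)
  have c: "0 < c" using assms s by (auto simp: c_def c_in_def)
  have cs: "c * (1 + \<delta> * (\<alpha> + \<gamma>)) = 1 - \<gamma>" using s by (simp add: c_def c_in_def)
  define f where "f = f_in \<alpha> \<gamma> \<delta>"
  have f0: "f 0 = \<alpha> / (1 + \<delta> * c)" by (simp add: f_def f_in_def c_def Let_def)
  have f_pos: "f d = C_in \<alpha> \<gamma> \<delta> * Gamma (real d + \<delta>) / Gamma (real d + \<delta> + 1 + 1 / c)" if "d \<ge> 1" for d
    using that by (simp add: f_def f_in_def c_def Let_def)
  have f1: "f 1 = (1 - c) / ((1 + \<delta> * c) * (1 + \<delta> * c + c))"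
  proof -
    define x where "x = \<delta> + 1 / c"
    have x: "x > 0" using c assms by (simp add: x_def add_nonneg_pos)
    have G: "Gamma (1 + \<delta> + 1 + 1 / c) = (x + 1) * (x * Gamma x)"
      using x Gamma_plus1[of x] Gamma_plus1[of "x + 1"] by (simp add: x_def add_ac nonpos_Ints_def)
    have "Gamma x \<noteq> 0" "Gamma (1 + \<delta>) \<noteq> 0"
      using Gamma_real_pos[of x] Gamma_real_pos[of "1 + \<delta>"] x assms by linarith+
    then have "f 1 = (1 - c) / c\<^sup>2 / ((x + 1) * x)"
      unfolding f_pos[OF order_refl] of_nat_1 G C_in_def Let_def c_def[symmetric] x_def[symmetric] using x
      by simp
    also have "\<dots> = (1 - c) / ((1 + \<delta> * c) * (1 + \<delta> * c + c))"
    proof -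
      have "c\<^sup>2 * ((x + 1) * x) = (1 + \<delta> * c) * (1 + \<delta> * c + c)"
        using c by (simp add: x_def power2_eq_square field_simps)
      then show ?thesis by (simp add: divide_divide_eq_left)
    qed
    finally show ?thesis .
  qed
  consider "d = 0" | "d = 1" | j where "d = Suc j" "j \<ge> 1" by (cases d) (auto, metis One_nat_def Suc_le_eq neq0_conv)
  then have "f d = c * flow \<delta> f d + (\<alpha> * of_bool (d = 0) + \<gamma> * of_bool (d = 1))"
  proof cases
    case 1
    have "1 + \<delta> * c > 0" using c assms by (simp add: add_pos_nonneg)
    then have "f 0 * (1 + \<delta> * c) = \<alpha>" using f0 by simp
    then show ?thesis using 1 by (simp add: flow_def algebra_simps)
  next
    case 2
    have p: "1 + \<delta> * c > 0" "1 + \<delta> * c + c > 0" using c assms by (simp_all add: add_pos_nonneg)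
    have "f 1 * (1 + \<delta> * c + c) = (1 - c) / (1 + \<delta> * c)" using f1 p by simp
    \<comment> \<open>A rearrangement of the definition of \<open>c\<close> that separates the
      inflow from degree 0 from the births in degree 1.\<close>
    also have "1 - c = c * \<delta> * \<alpha> + \<gamma> * (1 + \<delta> * c)" using cs by (simp add: algebra_simps)
    also have "(c * \<delta> * \<alpha> + \<gamma> * (1 + \<delta> * c)) / (1 + \<delta> * c) = c * \<delta> * f 0 + \<gamma>"
      using p by (simp add: f0 add_divide_distrib)
    finally show ?thesis using 2 by (simp add: flow_def algebra_simps)
  next
    case 3
    define x where "x = real j + \<delta>"
    have x: "x > 0" using 3 assms by (simp add: x_def add_pos_nonneg)
    define y where "y = x + 1 + 1 / c"
    have y: "y > 0" using x c by (simp add: y_def add_pos_pos)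
    have "Gamma (real d + \<delta>) = x * Gamma x"
      using Gamma_plus1[of x] x 3 by (simp add: x_def add_ac nonpos_Ints_def)
    moreover have "Gamma (real d + \<delta> + 1 + 1 / c) = y * Gamma y"
      using Gamma_plus1[of y] y 3 by (simp add: x_def y_def add_ac nonpos_Ints_def)
    ultimately have "f d = x / y * (C_in \<alpha> \<gamma> \<delta> * Gamma x / Gamma y)" using f_pos[of d] 3 by simp
    also have "C_in \<alpha> \<gamma> \<delta> * Gamma x / Gamma y = f j" using f_pos[of j] 3 by (simp add: x_def y_def)
    finally have "f d * y = x * f j" using y by simp
    then have "f d * (c * y) = c * (x * f j)" by (simp add: mult_ac)
    moreover have "c * y = c * (x + 1) + 1" using c by (simp add: y_def algebra_simps)
    ultimately show ?thesis using 3 by (simp add: flow_def x_def algebra_simps)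
  qed
  then show ?thesis by (simp add: f_def c_def)
qed

section \<open>Transfer of the estimate to the graph process\<close>

theorem theorem1:
  fixes \<alpha> \<beta> \<gamma> \<delta>\<^sub>i\<^sub>n \<delta>\<^sub>o\<^sub>u\<^sub>t \<epsilon> :: real
    and G\<^sub>0 :: "('a::infinite, 'b::infinite) pre_digraph"
  assumes "\<alpha> \<in> {0..1}" and "\<beta> \<in> {0..1}" and "\<gamma> \<in> {0..1}" and "\<alpha> + \<beta> + \<gamma> = 1"
    and "\<delta>\<^sub>i\<^sub>n \<ge> 0" and "\<delta>\<^sub>o\<^sub>u\<^sub>t \<ge> 0"
    and "fin_digraph G\<^sub>0" and "verts G\<^sub>0 \<noteq> {}"
    and "\<delta>\<^sub>i\<^sub>n = 0 \<or> \<delta>\<^sub>o\<^sub>u\<^sub>t = 0 \<Longrightarrow> arcs G\<^sub>0 \<noteq> {}"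
    and "\<alpha> + \<gamma> > 0"
    and "\<alpha> + \<beta> > 0" and "\<gamma> + \<delta>\<^sub>i\<^sub>n > 0"
    and "\<epsilon> > 0"
  shows "\<exists>K. \<forall>t \<ge> max (card (arcs G\<^sub>0)) 1. \<forall>d.
           \<bar>measure_pmf.expectation (graph_at \<alpha> \<beta> \<gamma> \<delta>\<^sub>i\<^sub>n \<delta>\<^sub>o\<^sub>u\<^sub>t G\<^sub>0 t) (\<lambda>G. real (n_in G d))
             - f_in \<alpha> \<gamma> \<delta>\<^sub>i\<^sub>n d * real t\<bar>
           \<le> K * (real d + 1) powr (- 1 + \<epsilon>)"
proof -
  have par: "\<alpha> \<ge> 0" "\<beta> \<ge> 0" "\<gamma> \<ge> 0" "\<alpha> + \<beta> + \<gamma> = 1" "\<gamma> < 1" using assms by auto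
  interpret G0: fin_digraph G\<^sub>0 by fact
  have v: "card (verts G\<^sub>0) > 0" using assms by (simp add: card_gt_0_iff)
  have pos: "real (card (arcs G\<^sub>0)) + \<delta> * real (card (verts G\<^sub>0)) > 0"
    if "\<delta> \<ge> 0" "\<delta> = 0 \<Longrightarrow> arcs G\<^sub>0 \<noteq> {}" for \<delta>
  proof (cases "\<delta> = 0")
    case True
    then show ?thesis using that by (simp add: card_gt_0_iff)
  next
    case False
    then show ?thesis using that v by (simp add: add_nonneg_pos)
  qed
  interpret attachable G\<^sub>0 \<delta>\<^sub>i\<^sub>n \<delta>\<^sub>o\<^sub>u\<^sub>t
    by unfold_locales (use assms pos in auto)
  interpret in_degree_counts \<alpha> \<beta> \<gamma> \<delta>\<^sub>i\<^sub>n "card (arcs G\<^sub>0)" "card (verts G\<^sub>0)"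
    "\<lambda>ms d. measure_pmf.expectation (graph_given \<delta>\<^sub>i\<^sub>n \<delta>\<^sub>o\<^sub>u\<^sub>t G\<^sub>0 ms) (\<lambda>H. real (n_in H d))"
    by (rule in_degree_counts_given) (use assms par in auto)
  have "\<gamma> + \<delta>\<^sub>i\<^sub>n * (\<alpha> + \<gamma>) > 0"
  proof (cases "\<gamma> = 0")
    case False
    then show ?thesis using par assms by (simp add: add_pos_nonneg)
  qed (use assms in auto)
  then have f: "f_in \<alpha> \<gamma> \<delta>\<^sub>i\<^sub>n d \<ge> 0" for d
    using par assms by (intro f_in_nonneg) auto
  have "c_in \<alpha> \<gamma> \<delta>\<^sub>i\<^sub>n = (1 - \<gamma>) / \<sigma>" by (simp add: c_in_def \<sigma>_def \<nu>_def)
  then have f_rec: "f_in \<alpha> \<gamma> \<delta>\<^sub>i\<^sub>n d = (1 - \<gamma>) / \<sigma> * flow \<delta>\<^sub>i\<^sub>n (f_in \<alpha> \<gamma> \<delta>\<^sub>i\<^sub>n) d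
      + (\<alpha> * of_bool (d = 0) + \<gamma> * of_bool (d = 1))" for d
    using f_in_rec[of \<alpha> \<gamma> \<delta>\<^sub>i\<^sub>n d] par assms by simp
  obtain H where H: "\<And>k d. \<bar>avg \<alpha> \<beta> \<gamma> k (\<lambda>ms. measure_pmf.expectation (graph_given \<delta>\<^sub>i\<^sub>n \<delta>\<^sub>o\<^sub>u\<^sub>t G\<^sub>0 ms) (\<lambda>H. real (n_in H d)))
      - f_in \<alpha> \<gamma> \<delta>\<^sub>i\<^sub>n d * real (card (arcs G\<^sub>0) + k)\<bar> \<le> H * ((1 + ln (real d + 1)) / (real d + 1))"
    using E_q_asymptotics[OF f f_rec] by blast
  \<comment> \<open>The logarithm is traded for an arbitrarily small power;
    \<open>\<epsilon>\<close> enters only here and in the final constant.\<close>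
  have ln_le: "(1 + ln (real d + 1)) / (real d + 1) \<le> (1 + 1 / \<epsilon>) * (real d + 1) powr (- 1 + \<epsilon>)" for d
  proof -
    have "ln (real d + 1) \<le> (real d + 1) powr \<epsilon> / \<epsilon>" using assms by (intro ln_powr_bound) auto
    moreover have "1 \<le> (real d + 1) powr \<epsilon>" using assms by (simp add: ge_one_powr_ge_zero)
    ultimately have "1 + ln (real d + 1) \<le> (1 + 1 / \<epsilon>) * (real d + 1) powr \<epsilon>"
      by (simp add: distrib_right)
    then have "(1 + ln (real d + 1)) / (real d + 1) \<le> (1 + 1 / \<epsilon>) * (real d + 1) powr \<epsilon> / (real d + 1)"
      by (intro divide_right_mono) auto
    moreover have "(real d + 1) powr (- 1 + \<epsilon>) = (real d + 1) powr \<epsilon> / (real d + 1)"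
      using powr_diff[of "real d + 1" \<epsilon> 1] by simp
    ultimately show ?thesis by simp
  qed
  show ?thesis
  proof (intro exI[of _ "\<bar>H\<bar> * (1 + 1 / \<epsilon>)"] allI impI)
    fix t d assume "t \<ge> max (card (arcs G\<^sub>0)) 1"
    \<comment> \<open>As \<open>t\<close> is at least the initial number of arcs, the truncated
      subtraction in \<open>graph_at\<close> is exact.\<close>
    then have t: "card (arcs G\<^sub>0) + (t - card (arcs G\<^sub>0)) = t" by simp
    have "\<bar>measure_pmf.expectation (graph_at \<alpha> \<beta> \<gamma> \<delta>\<^sub>i\<^sub>n \<delta>\<^sub>o\<^sub>u\<^sub>t G\<^sub>0 t) (\<lambda>G. real (n_in G d))
        - f_in \<alpha> \<gamma> \<delta>\<^sub>i\<^sub>n d * real t\<bar> \<le> H * ((1 + ln (real d + 1)) / (real d + 1))"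
      using H[of "t - card (arcs G\<^sub>0)" d] unfolding t graph_at_def expectation_graph_after[OF par(1-4)] .
    also have "\<dots> \<le> \<bar>H\<bar> * ((1 + ln (real d + 1)) / (real d + 1))"
      by (intro mult_right_mono divide_nonneg_nonneg add_nonneg_nonneg) auto
    also have "\<dots> \<le> \<bar>H\<bar> * ((1 + 1 / \<epsilon>) * (real d + 1) powr (- 1 + \<epsilon>))"
      by (intro mult_left_mono ln_le) auto
    finally show "\<bar>measure_pmf.expectation (graph_at \<alpha> \<beta> \<gamma> \<delta>\<^sub>i\<^sub>n \<delta>\<^sub>o\<^sub>u\<^sub>t G\<^sub>0 t) (\<lambda>G. real (n_in G d))
        - f_in \<alpha> \<gamma> \<delta>\<^sub>i\<^sub>n d * real t\<bar> \<le> \<bar>H\<bar> * (1 + 1 / \<epsilon>) * (real d + 1) powr (- 1 + \<epsilon>)"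
      by (simp only: mult.assoc)
  qed
qed

end
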